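(* Let $T$ be a real, non-singular $d\times d$ matrix, regarded as a transformation of the torus $\mathbb{T}^d$. Suppose that $T$ is diagonal and that all its eigenvalues $\beta_1,\dots,\beta_d$ are of modulus strictly larger than $1$. Assume that $1<\beta_1\le\beta_2\le\dots\le\beta_d$. Let $\psi$ be a positive function on $\mathbb{N}$, let $\tau:=\liminf_{n\to\infty}\frac{-\log\psi(n)}{n}$, and let $$H_d(T,\psi)=\Big\{\mathbf{x}=(x_1,\dots,x_d)\in\mathbb{T}^d:\ \prod_{i=1}^d|T_{\beta_i}^n(x_i)-x_i|<\psi(n)\ \text{for infinitely many } n\in\mathbb{N}\Big\}.$$ Then $$\dim_{\mathrm H}H_d(T,\psi)=d-1+\frac{\log\beta_d}{\tau+\log\beta_d}.$$
   Context: $\mathbb{T}^d=\mathbb{R}^d/\mathbb{Z}^d$ is identified with $[0,1)^d$; $|\cdot|$ is the usual metric on $\mathbb{T}$ (distance of the difference to the nearest integer). A real matrix $T$ acts on $\mathbb{T}^d$ by $\mathbf{x}\mapsto T\mathbf{x}\ (\mathrm{mod}\ 1)$ and $T^n$ is the $n$-th iterate of this map. For $T=\mathrm{diag}(\beta_1,\dots,\beta_d)$ with $\beta_i>1$, $T^n(\mathbf{x})=(T_{\beta_1}^n(x_1),\dots,T_{\beta_d}^n(x_d))$, where $T_\beta:[0,1)\to[0,1)$, $T_\beta(x)=\beta x-\lfloor\beta x\rfloor$, is the $\beta$-transformation. $\dim_{\mathrm H}$ is Hausdorff dimension.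
   Formalization: The formal theorem assumes τ ≥ 0; for τ < 0 one has ψ(n) > 1 infinitely often, so H_d(T,ψ) is the whole torus of dimension d and the displayed formula fails or is undefined (e.g. β_d = 4, ψ(n) = 2^n gives d+1). *)

theory Defs
  imports "HOL-Analysis.Analysis"
begin

text \<open>Convention: the \<open>s\<close>-th power of the diameter of the empty set is \<open>0\<close>, and for \<open>s = 0\<close> every
  nonempty set contributes \<open>1\<close>. This needs a case distinction because \<open>0 powr 0 = 0\<close> in HOL.\<close>

definition diam_pow :: "real \<Rightarrow> 'a::metric_space set \<Rightarrow> ennreal" where
  "diam_pow s U = (if U = {} then 0 else if s = 0 then 1 else ennreal (diameter U powr s))"

text \<open>The covering sets are required to be bounded since \<^const>\<open>diameter\<close> is only meaningful for
  bounded sets.\<close>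

definition hausdorff_premeasure :: "real \<Rightarrow> real \<Rightarrow> 'a::metric_space set \<Rightarrow> ennreal" where
  "hausdorff_premeasure s \<delta> A =
     (INF U \<in> {U :: nat \<Rightarrow> 'a set. A \<subseteq> (\<Union>k. U k) \<and> (\<forall>k. bounded (U k) \<and> diameter (U k) \<le> \<delta>)}.
        \<Sum>k. diam_pow s (U k))"

definition hausdorff_measure :: "real \<Rightarrow> 'a::metric_space set \<Rightarrow> ennreal" where
  "hausdorff_measure s A = (SUP \<delta> \<in> {0<..}. hausdorff_premeasure s \<delta> A)"

definition hausdorff_dim :: "'a::metric_space set \<Rightarrow> ereal" where
  "hausdorff_dim A = Inf (ereal ` {s. 0 \<le> s \<and> hausdorff_measure s A = 0})"

text \<open>The torus is identified with the half-open unit cube \<open>[0,1)\<^sup>d\<close>, equipped with the Euclidean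
  metric for the purpose of Hausdorff dimension. The quotient metric agrees with a Euclidean one
  on subsets of small diameter of each of finitely many small subcubes, so both metrics give the
  same dimension.\<close>

definition torus :: "(real ^ 'n) set" where
  "torus = {x. \<forall>i. x $ i \<in> {0..<1}}"

definition torus_map :: "real ^ 'n ^ 'n \<Rightarrow> real ^ 'n \<Rightarrow> real ^ 'n" where
  "torus_map T x = (\<chi> i. frac ((T *v x) $ i))"

definition circle_dist :: "real \<Rightarrow> real \<Rightarrow> real" where
  "circle_dist x y = infdist (x - y) \<int>"

definition beta_transform :: "real \<Rightarrow> real \<Rightarrow> real" where
  "beta_transform \<beta> x = \<beta> * x - of_int \<lfloor>\<beta> * x\<rfloor>"

text \<open>The set \<open>H\<^sub>d(T, \<psi>)\<close> for a diagonal matrix \<open>T\<close>, with \<open>\<beta>\<^sub>i\<close> the \<open>i\<close>-th diagonal entry.\<close>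

definition hyperbolic_recurrent :: "real ^ 'n ^ 'n \<Rightarrow> (nat \<Rightarrow> real) \<Rightarrow> (real ^ 'n) set" where
  "hyperbolic_recurrent T \<psi> =
     {x \<in> torus. \<exists>\<^sub>\<infinity>n.
        (\<Prod>i\<in>UNIV. circle_dist ((beta_transform (T $ i $ i) ^^ n) (x $ i)) (x $ i)) < \<psi> n}"

lemma torus_map_in_torus: "torus_map T x \<in> torus"
  by (simp add: torus_map_def torus_def frac_lt_1)

lemma torus_map_diagonal_nth:
  assumes diag: "\<And>i j. i \<noteq> j \<Longrightarrow> T $ i $ j = 0"
  shows "torus_map T x $ i = beta_transform (T $ i $ i) (x $ i)"
proof -
  have "(\<Sum>j\<in>UNIV. T $ i $ j * x $ j) = (\<Sum>j\<in>UNIV. if j = i then T $ i $ i * x $ i else 0)"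
    by (rule sum.cong) (auto simp: diag)
  then have "(T *v x) $ i = T $ i $ i * x $ i"
    by (simp add: matrix_vector_mult_def)
  then show ?thesis
    by (simp add: torus_map_def beta_transform_def frac_def)
qed

lemma torus_map_diagonal_iterate_nth:
  assumes diag: "\<And>i j. i \<noteq> j \<Longrightarrow> T $ i $ j = 0"
  shows "(torus_map T ^^ n) x $ i = (beta_transform (T $ i $ i) ^^ n) (x $ i)"
  by (induction n) (simp_all add: torus_map_diagonal_nth[OF diag])

text \<open>Hence, for diagonal \<open>T\<close>, the set is expressed through the iterates of the torus map.\<close>

lemma hyperbolic_recurrent_torus_map:
  assumes "\<And>i j. i \<noteq> j \<Longrightarrow> T $ i $ j = 0"
  shows "hyperbolic_recurrent T \<psi> =
    {x \<in> torus. \<exists>\<^sub>\<infinity>n. (\<Prod>i\<in>UNIV. circle_dist ((torus_map T ^^ n) x $ i) (x $ i)) < \<psi> n}"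
  by (simp add: hyperbolic_recurrent_def torus_map_diagonal_iterate_nth[OF assms])

end

theory Submission
  imports Defs
begin

text \<open>Write \<open>d\<close> for the dimension, \<open>B\<close> for the largest eigenvalue and \<open>L = ln B\<close>.

  \<^bold>\<open>Upper bound.\<close> For \<open>t < \<tau>\<close> eventually \<open>\<psi> n < exp (- t * n)\<close>, so \<open>\<psi>\<close> may be replaced by
  \<open>exp (- t * n)\<close>; for \<open>\<tau> = 0\<close> take \<open>t = 0\<close>, as all products are
  less than \<open>1\<close>. Let \<open>E\<^sub>n\<close> be the set of points
  whose product at time \<open>n\<close> is less than \<open>\<psi> n\<close>. At the single scale \<open>\<delta> = \<psi> n / B ^ n\<close> all
  coordinates can be treated alike: within a cylinder, a displacement by \<open>\<delta>\<close> changes \<open>T\<^sup>n x\<^sub>i\<close> by at most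
  \<open>\<psi> n\<close>, so the
  \<open>\<delta>\<close>-neighbourhood of \<open>E\<^sub>n\<close> lies in a set of the same kind with \<open>\<psi> n\<close> replaced by
  \<open>2 ^ d * \<psi> n\<close>. Its volume is about \<open>\<psi> n\<close>, up to subexponential factors, so \<open>E\<^sub>n\<close> is covered by
  about \<open>\<psi> n * \<delta> powr (- d)\<close> cubes of side \<open>\<delta>\<close>. The sum of
  \<open>\<psi> n * \<delta> powr (s - d)\<close> over \<open>n\<close> converges iff \<open>s > d - 1 + L / (t + L)\<close>
  (\<open>hyperbolic_neighbourhood_cover\<close>, \<open>hausdorff_measure_recurrent_eq_0\<close>). The count needs that there
  are at most a constant times \<open>\<beta> ^ n\<close> cylinders of order \<open>n\<close> (\<open>card_cylinder_starts\<close>).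

  \<^bold>\<open>Lower bound.\<close> All factors are at most \<open>1\<close>, so the set contains every point of the torus whose
  coordinate with eigenvalue \<open>B\<close> is recurrent at rate \<open>\<psi>\<close>. It therefore suffices to treat one coordinate and to
  add \<open>d - 1\<close>. For \<open>\<theta> < L / (\<tau> + L)\<close> there is a map \<open>\<gamma>\<close> from \<open>[0,1)\<close> into the recurrent points of one
  coordinate with \<open>|s - s'| \<le> 4 * |\<gamma> s - \<gamma> s'| powr \<theta>\<close>; replacing the coordinate by its image
  under \<open>\<gamma>\<close> maps the torus into the set, and Lebesgue measure shows that the Hausdorff measure of the
  image in dimension \<open>d - 1 + \<theta>\<close> is positive (\<open>hausdorff_measure_fibred_ne_0\<close>). The map is a Cantor
  scheme (\<open>expanding_map_into_limsup\<close>). It only needs that the points recurrent at time \<open>n\<close> contain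
  intervals of length about \<open>\<psi> n / B ^ n\<close> spaced at distance about \<open>n / B ^ n\<close>
  (\<open>recurrent_interval\<close>). Such an interval exists in every full cylinder of order \<open>n\<close>, and full
  cylinders are that dense (\<open>full_cylinder_in_interval\<close>). For \<open>\<tau> = \<infinity>\<close> the fixed point \<open>0\<close> and
  constant \<open>\<gamma>\<close> suffice.\<close>

section \<open>Estimates for Hausdorff measures\<close>

lemma hausdorff_measure_eq_0_iff:
  "hausdorff_measure s A = 0 \<longleftrightarrow> (\<forall>\<delta>>0. hausdorff_premeasure s \<delta> A = 0)"
proof -
  have "hausdorff_measure s A = 0 \<longleftrightarrow> hausdorff_measure s A \<le> 0" by simp
  also have "\<dots> \<longleftrightarrow> (\<forall>\<delta>>0. hausdorff_premeasure s \<delta> A \<le> 0)"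
    unfolding hausdorff_measure_def SUP_le_iff by auto
  finally show ?thesis by simp
qed

lemma diam_pow_antimono:
  assumes "0 \<le> s" "s \<le> s'" "bounded U" "diameter U \<le> 1"
  shows "diam_pow s' U \<le> diam_pow s U"
proof -
  have d: "0 \<le> diameter U" using assms(3) by (rule diameter_ge_0)
  have "ennreal (diameter U powr s') \<le> 1" if "0 < s'"
    using d assms(4) that by (simp add: powr_le1)
  moreover have "diameter U powr s' \<le> diameter U powr s"
    using assms d by (intro powr_mono') auto
  ultimately show ?thesis
    using assms(1,2) by (auto simp: diam_pow_def intro: ennreal_leI)
qed

lemma hausdorff_measure_eq_0_mono:
  assumes "0 \<le> s" "s \<le> s'" and zero: "hausdorff_measure s A = 0"
  shows "hausdorff_measure s' A = 0"
  unfolding hausdorff_measure_eq_0_iff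
proof (intro allI impI)
  fix \<delta> :: real assume "0 < \<delta>"
  have "hausdorff_premeasure s' \<delta> A \<le> hausdorff_premeasure s (min \<delta> 1) A"
    unfolding hausdorff_premeasure_def
  proof (rule INF_superset_mono)
    fix U :: "nat \<Rightarrow> 'a set"
    assume "U \<in> {U. A \<subseteq> (\<Union>k. U k) \<and> (\<forall>k. bounded (U k) \<and> diameter (U k) \<le> min \<delta> 1)}"
    then show "(\<Sum>k. diam_pow s' (U k)) \<le> (\<Sum>k. diam_pow s (U k))"
      using assms(1,2) by (intro suminf_le diam_pow_antimono) auto
  qed auto
  also have "\<dots> = 0"
    using zero \<open>0 < \<delta>\<close> by (simp add: hausdorff_measure_eq_0_iff)
  finally show "hausdorff_premeasure s' \<delta> A = 0" by simp
qed

lemma hausdorff_dim_eqI: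
  assumes "0 \<le> D"
    and upper: "\<And>s. D < s \<Longrightarrow> hausdorff_measure s A = 0"
    and lower: "\<And>s. 0 \<le> s \<Longrightarrow> s < D \<Longrightarrow> hausdorff_measure s A \<noteq> 0"
  shows "hausdorff_dim A = ereal D"
proof (rule antisym)
  show "hausdorff_dim A \<le> ereal D"
  proof (rule ereal_le_epsilon2)
    fix e :: real assume "0 < e"
    then show "hausdorff_dim A \<le> ereal D + ereal e"
      unfolding hausdorff_dim_def using assms(1) upper by (auto intro!: Inf_lower)
  qed
  show "ereal D \<le> hausdorff_dim A"
    unfolding hausdorff_dim_def using lower by (intro Inf_greatest) (force simp: not_less)
qed

text \<open>The Hausdorff version of the Borel--Cantelli lemma.\<close>

lemma hausdorff_measure_limsup_eq_0:
  fixes A :: "'a::metric_space set" and I :: "nat \<Rightarrow> 'i set" and U :: "nat \<Rightarrow> 'i \<Rightarrow> 'a set"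
  assumes s: "0 < s"
    and limsup: "\<And>x. x \<in> A \<Longrightarrow> \<exists>\<^sub>\<infinity>n. \<exists>i\<in>I n. x \<in> U n i"
    and fin: "\<And>n. finite (I n)"
    and bnd: "\<And>n i. i \<in> I n \<Longrightarrow> bounded (U n i) \<and> diameter (U n i) \<le> \<delta> n"
    and \<delta>: "\<delta> \<longlonglongrightarrow> 0"
    and summable: "summable (\<lambda>n. card (I n) * \<delta> n powr s)"
  shows "hausdorff_measure s A = 0"
  unfolding hausdorff_measure_eq_0_iff
proof (intro allI impI)
  fix \<delta>' :: real assume \<delta>': "0 < \<delta>'"
  define c where "c n = card (I n) * \<delta> n powr s" for n
  have c0: "0 \<le> c n" for n by (simp add: c_def)
  have "hausdorff_premeasure s \<delta>' A \<le> 0 + ennreal e" if e: "0 < e" for e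
  proof -
    obtain n1 where n1: "\<And>n. n1 \<le> n \<Longrightarrow> \<delta> n < \<delta>'"
      using order_tendstoD(2)[OF \<delta> \<delta>'] by (auto simp: eventually_sequentially)
    obtain n2 where n2: "\<And>n. n2 \<le> n \<Longrightarrow> norm (\<Sum>i. c (i + n)) < e"
      using suminf_exist_split[OF e summable] unfolding c_def by blast
    define m where "m = max n1 n2"
    obtain b where b: "\<And>n. bij_betw (b n) {0..<card (I n)} (I n)"
      using ex_bij_betw_nat_finite[OF fin] by metis
    define V where "V = (\<lambda>(n, k). if k < card (I (n + m)) then U (n + m) (b (n + m) k) else {})"
    have bI: "b n k \<in> I n" if "k < card (I n)" for n k
      using b[of n] that by (auto simp: bij_betw_def)
    have V: "bounded (V p) \<and> diameter (V p) \<le> \<delta>'" for p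
    proof -
      obtain n k where p: "p = (n, k)" by (cases p)
      have "\<delta> (n + m) < \<delta>'" using n1 by (simp add: m_def)
      then show ?thesis
        using bnd[OF bI, of k "n + m"] \<delta>' by (auto simp: V_def p)
    qed
    have cover: "A \<subseteq> (\<Union>i. V (prod_decode i))"
    proof
      fix x assume "x \<in> A"
      from limsup[OF this] obtain n i where n: "m \<le> n" "i \<in> I n" "x \<in> U n i"
        unfolding INFM_nat_le by blast
      obtain k where k: "k < card (I n)" "b n k = i"
        using b[of n] n(2) by (force simp: bij_betw_def)
      have "x \<in> V (n - m, k)" using n k by (simp add: V_def)
      then show "x \<in> (\<Union>i. V (prod_decode i))"
        by (metis UN_iff UNIV_I prod_encode_inverse)
    qed
    have "(\<Sum>k. diam_pow s (V (n, k))) \<le> ennreal (c (n + m))" for n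
    proof -
      have "(\<Sum>k. diam_pow s (V (n, k))) = (\<Sum>k<card (I (n + m)). diam_pow s (V (n, k)))"
        by (intro suminf_finite) (auto simp: V_def diam_pow_def)
      also have "\<dots> \<le> (\<Sum>k<card (I (n + m)). ennreal (\<delta> (n + m) powr s))"
      proof (intro sum_mono)
        fix k assume "k \<in> {..<card (I (n + m))}"
        then have k: "b (n + m) k \<in> I (n + m)" using bI by simp
        have "diameter (U (n + m) (b (n + m) k)) powr s \<le> \<delta> (n + m) powr s"
          using bnd[OF k] s diameter_ge_0 by (intro powr_mono2) auto
        then show "diam_pow s (V (n, k)) \<le> ennreal (\<delta> (n + m) powr s)"
          using s by (auto simp: diam_pow_def V_def intro: ennreal_leI)
      qed
      also have "\<dots> = ennreal (c (n + m))"
        by (simp add: c_def ennreal_mult ennreal_of_nat_eq_real_of_nat)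
      finally show ?thesis .
    qed
    then have "(\<Sum>n. \<Sum>k. diam_pow s (V (n, k))) \<le> (\<Sum>n. ennreal (c (n + m)))"
      by (intro suminf_le) auto
    also have "\<dots> = ennreal (\<Sum>n. c (n + m))"
      using summable c0 unfolding c_def[symmetric]
      by (intro suminf_ennreal2) (simp_all add: summable_iff_shift)
    also have "\<dots> \<le> ennreal e"
      using n2[of m] by (intro ennreal_leI) (simp add: m_def)
    finally have sum: "(\<Sum>n. \<Sum>k. diam_pow s (V (n, k))) \<le> ennreal e" .
    have "hausdorff_premeasure s \<delta>' A \<le> (\<Sum>i. diam_pow s (V (prod_decode i)))"
      unfolding hausdorff_premeasure_def using cover V by (intro INF_lower) auto
    also have "\<dots> = (\<Sum>n. \<Sum>k. diam_pow s (V (n, k)))"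
      using suminf_ennreal_2dimen[of "\<lambda>n. \<Sum>k. diam_pow s (V (n, k))" "\<lambda>p. diam_pow s (V p)"] by simp
    finally show ?thesis using sum by simp
  qed
  then have "hausdorff_premeasure s \<delta>' A \<le> 0" by (rule ennreal_le_epsilon)
  then show "hausdorff_premeasure s \<delta>' A = 0" by simp
qed

text \<open>If \<open>\<gamma>\<close> does not contract distances too much, then the preimage of a set of diameter \<open>r\<close> under
  \<open>y \<mapsto> y(i\<^sub>0 := \<gamma> (y i\<^sub>0))\<close> lies in a box whose volume is at most a constant times
  \<open>r ^ (d - 1) * r powr \<theta>\<close>. A cover of \<open>A\<close> pulls back to a cover of the cube, of volume \<open>1\<close>. This
  replaces the mass distribution principle for a product measure. The case \<open>\<theta> = 0\<close> allows constant \<open>\<gamma>\<close>.\<close>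

lemma hausdorff_measure_fibred_ne_0:
  fixes A :: "(real ^ 'n) set" and \<gamma> :: "real \<Rightarrow> real" and i0 :: 'n
  defines "w \<equiv> (\<lambda>\<theta> r :: real. if \<theta> = 0 then 1 else r powr \<theta>)"
  assumes \<theta>: "0 \<le> \<theta>" and C: "0 < C"
    and into: "\<And>y. y \<in> torus \<Longrightarrow> (\<chi> i. if i = i0 then \<gamma> (y $ i) else y $ i) \<in> A"
    and expanding: "\<And>s t r. s \<in> {0..<1} \<Longrightarrow> t \<in> {0..<1} \<Longrightarrow> \<bar>\<gamma> s - \<gamma> t\<bar> \<le> r \<Longrightarrow> \<bar>s - t\<bar> \<le> C * w \<theta> r"
  shows "hausdorff_measure (real CARD('n) - 1 + \<theta>) A \<noteq> 0"
proof
  define d where "d = CARD('n) - 1"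
  define s where "s = real d + \<theta>"
  have d: "CARD('n) = Suc d" by (simp add: d_def)
  define K where "K = 2 ^ Suc d * C"
  have K: "0 < K" using C by (simp add: K_def)
  define G where "G y = (\<chi> i. if i = i0 then \<gamma> (y $ i) else y $ i)" for y :: "real ^ 'n"
  assume "hausdorff_measure (real CARD('n) - 1 + \<theta>) A = 0"
  then have "hausdorff_premeasure s 1 A = 0"
    unfolding hausdorff_measure_eq_0_iff by (simp add: s_def d)
  then have "hausdorff_premeasure s 1 A < ennreal (1 / (2 * K))"
    using K by simp
  then obtain U :: "nat \<Rightarrow> (real ^ 'n) set" where U: "A \<subseteq> (\<Union>k. U k)" "\<And>k. bounded (U k)"
    and sum: "(\<Sum>k. diam_pow s (U k)) < ennreal (1 / (2 * K))"
    unfolding hausdorff_premeasure_def INF_less_iff by auto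
  define covers where "covers k B \<longleftrightarrow> B \<in> sets lborel \<and> {y \<in> torus. G y \<in> U k} \<subseteq> B \<and>
      emeasure lborel B \<le> ennreal K * diam_pow s (U k)" for k B
  have "\<exists>B. covers k B" for k
  proof (cases "\<exists>y\<in>torus. G y \<in> U k")
    case False
    then show ?thesis by (intro exI[of _ "{}"]) (auto simp: covers_def)
  next
    case True
    then obtain y0 where y0: "y0 \<in> torus" "G y0 \<in> U k" by blast
    define r where "r = diameter (U k)"
    have r: "0 \<le> r" unfolding r_def using U(2) by (rule diameter_ge_0)
    have w: "0 \<le> w \<theta> r" using r by (simp add: w_def)
    define \<rho> where "\<rho> i = (if i = i0 then C * w \<theta> r else r)" for i
    have \<rho>: "0 \<le> \<rho> i" for i using r C w by (simp add: \<rho>_def)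
    define B where "B = cbox (\<chi> i. y0 $ i - \<rho> i) (\<chi> i. y0 $ i + \<rho> i)"
    have sub: "{y \<in> torus. G y \<in> U k} \<subseteq> B"
    proof safe
      fix y assume y: "y \<in> torus" "G y \<in> U k"
      have dist: "\<bar>G y $ i - G y0 $ i\<bar> \<le> r" for i
      proof -
        have "\<bar>(G y - G y0) $ i\<bar> \<le> norm (G y - G y0)" by (rule component_le_norm_cart)
        also have "\<dots> \<le> r"
          unfolding r_def using diameter_bounded_bound[OF U(2) y(2) y0(2)] by (simp add: dist_norm)
        finally show ?thesis by simp
      qed
      have "\<bar>y $ i - y0 $ i\<bar> \<le> \<rho> i" for i
      proof (cases "i = i0")
        case True
        have "\<bar>\<gamma> (y $ i0) - \<gamma> (y0 $ i0)\<bar> \<le> r" using dist[of i0] by (simp add: G_def)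
        then show ?thesis
          using expanding[of "y $ i0" "y0 $ i0" r] y(1) y0(1) True by (simp add: torus_def \<rho>_def)
      next
        case False
        then show ?thesis using dist[of i] by (simp add: G_def \<rho>_def)
      qed
      then show "y \<in> B"
        unfolding B_def mem_box_cart by (simp add: abs_diff_le_iff algebra_simps)
    qed
    have "measure lborel B = (\<Prod>i\<in>UNIV. 2 * \<rho> i)"
    proof -
      have "y0 \<in> B" using \<rho> by (simp add: B_def mem_box_cart)
      then show ?thesis unfolding B_def by (subst content_cbox_cart) auto
    qed
    also have "\<dots> = 2 * \<rho> i0 * (\<Prod>i\<in>UNIV - {i0}. 2 * \<rho> i)"
      by (rule prod.remove) auto
    also have "(\<Prod>i\<in>UNIV - {i0}. 2 * \<rho> i) = (\<Prod>i\<in>UNIV - {i0}. 2 * r)"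
      by (rule prod.cong) (auto simp: \<rho>_def)
    also have "\<dots> = (2 * r) ^ d" by (simp add: d_def)
    also have "2 * \<rho> i0 * (2 * r) ^ d = K * (r ^ d * w \<theta> r)"
      by (simp add: \<rho>_def K_def power_mult_distrib)
    finally have vol: "measure lborel B = K * (r ^ d * w \<theta> r)" .
    have "ennreal (r ^ d * w \<theta> r) \<le> diam_pow s (U k)"
    proof -
      have "r ^ d * w \<theta> r \<le> (if s = 0 then 1 else r powr s)"
        using r \<theta> by (cases "r = 0") (auto simp: w_def s_def powr_add powr_realpow power_0_left)
      then show ?thesis
        using y0(2) by (auto simp: diam_pow_def r_def[symmetric] intro: ennreal_leI split: if_splits)
    qed
    then have "ennreal K * ennreal (r ^ d * w \<theta> r) \<le> ennreal K * diam_pow s (U k)"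
      by (rule mult_left_mono) simp
    moreover have "emeasure lborel B = ennreal (measure lborel B)"
      unfolding B_def by (intro emeasure_eq_ennreal_measure) (simp add: emeasure_lborel_cbox_eq)
    ultimately have "emeasure lborel B \<le> ennreal K * diam_pow s (U k)"
      using K r w by (simp add: vol ennreal_mult)
    moreover have "B \<in> sets lborel" by (simp add: B_def)
    ultimately show ?thesis using sub unfolding covers_def by blast
  qed
  then obtain B where "\<And>k. covers k (B k)" by metis
  then have B: "B k \<in> sets lborel" "{y \<in> torus. G y \<in> U k} \<subseteq> B k"
    "emeasure lborel (B k) \<le> ennreal K * diam_pow s (U k)" for k
    by (auto simp: covers_def)
  have "box 0 1 \<subseteq> (\<Union>k. B k)"
  proof
    fix y :: "real ^ 'n" assume "y \<in> box 0 1"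
    then have y: "y \<in> torus" by (auto simp: mem_box_cart torus_def less_imp_le)
    then obtain k where "G y \<in> U k" using into U(1) unfolding G_def by blast
    then show "y \<in> (\<Union>k. B k)" using B(2) y by blast
  qed
  moreover have "emeasure lborel (box 0 (1 :: real ^ 'n)) = 1"
  proof -
    have "emeasure lborel (box 0 (1 :: real ^ 'n)) = (\<Prod>b\<in>Basis. (1 - 0 :: real ^ 'n) \<bullet> b)"
      by (rule emeasure_lborel_box) (auto simp: Basis_vec_def inner_axis)
    also have "(\<Prod>b\<in>Basis. (1 - 0 :: real ^ 'n) \<bullet> b) = 1"
      by (rule prod.neutral) (auto simp: Basis_vec_def inner_axis)
    finally show ?thesis by simp
  qed
  ultimately have "1 \<le> emeasure lborel (\<Union>k. B k)"
    using B(1) by (metis emeasure_mono sets.countable_UN image_subset_iff UNIV_I subsetI)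
  also have "\<dots> \<le> (\<Sum>k. emeasure lborel (B k))"
    using B(1) by (intro emeasure_subadditive_countably) auto
  also have "\<dots> \<le> (\<Sum>k. ennreal K * diam_pow s (U k))"
    using B(3) by (intro suminf_le) auto
  also have "\<dots> = ennreal K * (\<Sum>k. diam_pow s (U k))"
    by simp
  also have "\<dots> \<le> ennreal K * ennreal (1 / (2 * K))"
    using sum by (intro mult_left_mono) (auto simp: less_imp_le)
  also have "\<dots> = ennreal (1 / 2)"
    using K by (simp flip: ennreal_mult)
  finally have "ennreal 1 \<le> ennreal (1 / 2)" by simp
  then show False by (subst (asm) ennreal_le_iff) auto
qed

section \<open>Cylinders of the beta-transformation\<close>

lemma beta_transform_range: "beta_transform \<beta> x \<in> {0..<1}"
  by (simp add: beta_transform_def) linarith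

lemma funpow_beta_transform_range:
  assumes "x \<in> {0..<1}"
  shows "(beta_transform \<beta> ^^ n) x \<in> {0..<1}"
  using assms beta_transform_range by (cases n) auto

lemma beta_transform_eqI:
  assumes "\<beta> * x = of_int k + u" "u \<in> {0..<1}"
  shows "beta_transform \<beta> x = u"
proof -
  have "\<lfloor>\<beta> * x\<rfloor> = k"
    using assms by (intro floor_unique) auto
  then show ?thesis
    using assms by (simp add: beta_transform_def)
qed

text \<open>The left endpoints of the full cylinders of order \<open>n\<close>: the cylinder \<open>[v, v + \<beta>\<^sup>-\<^sup>n)\<close> is mapped
  by the \<open>n\<close>-th iterate affinely onto all of \<open>[0,1)\<close>. Formulating fullness through this property
  avoids digit sequences altogether.\<close>

definition full_starts :: "real \<Rightarrow> nat \<Rightarrow> real set" where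
  "full_starts \<beta> n =
     {v. \<forall>u\<in>{0..<1}. v + u / \<beta> ^ n \<in> {0..<1} \<and> (beta_transform \<beta> ^^ n) (v + u / \<beta> ^ n) = u}"

text \<open>The left endpoint of the cylinder of order \<open>n\<close> that contains \<open>x\<close>.\<close>

definition cylinder_start :: "real \<Rightarrow> nat \<Rightarrow> real \<Rightarrow> real" where
  "cylinder_start \<beta> n x = x - (beta_transform \<beta> ^^ n) x / \<beta> ^ n"

text \<open>The orbit of \<open>1\<close> under the left-continuous version of the beta-transformation. The last cylinder
  of order \<open>k\<close> in \<open>[0,1)\<close> has length \<open>one_orbit \<beta> k / \<beta> ^ k\<close>.\<close>

primrec one_orbit :: "real \<Rightarrow> nat \<Rightarrow> real" where
  "one_orbit \<beta> 0 = 1"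
| "one_orbit \<beta> (Suc k) = \<beta> * one_orbit \<beta> k - of_int \<lceil>\<beta> * one_orbit \<beta> k\<rceil> + 1"

lemma one_orbit_range: "0 < one_orbit \<beta> k \<and> one_orbit \<beta> k \<le> 1"
proof (cases k)
  case (Suc j)
  have "of_int \<lceil>\<beta> * one_orbit \<beta> j\<rceil> < \<beta> * one_orbit \<beta> j + 1"
    "\<beta> * one_orbit \<beta> j \<le> of_int \<lceil>\<beta> * one_orbit \<beta> j\<rceil>"
    by linarith+
  then show ?thesis by (simp add: Suc)
qed simp

context
  fixes \<beta> :: real
  assumes beta: "1 < \<beta>"
begin

lemma full_starts_add:
  assumes "v \<in> full_starts \<beta> m" "w \<in> full_starts \<beta> k"
  shows "v + w / \<beta> ^ m \<in> full_starts \<beta> (m + k)"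
  unfolding full_starts_def
proof (intro CollectI ballI)
  fix u :: real assume u: "u \<in> {0..<1}"
  define y where "y = w + u / \<beta> ^ k"
  have y: "y \<in> {0..<1}" "(beta_transform \<beta> ^^ k) y = u"
    using assms(2) u by (auto simp: full_starts_def y_def)
  have z: "v + y / \<beta> ^ m \<in> {0..<1}" "(beta_transform \<beta> ^^ m) (v + y / \<beta> ^ m) = y"
    using assms(1) y by (auto simp: full_starts_def)
  have eq: "v + w / \<beta> ^ m + u / \<beta> ^ (m + k) = v + y / \<beta> ^ m"
    using beta by (simp add: y_def power_add field_simps)
  have "(beta_transform \<beta> ^^ (m + k)) (v + y / \<beta> ^ m) = u"
    using z y by (simp add: funpow_add add.commute[of m k])
  then show "v + w / \<beta> ^ m + u / \<beta> ^ (m + k) \<in> {0..<1} \<and>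
     (beta_transform \<beta> ^^ (m + k)) (v + w / \<beta> ^ m + u / \<beta> ^ (m + k)) = u"
    using z unfolding eq by simp
qed

lemma zero_full_starts: "0 \<in> full_starts \<beta> n"
proof (induction n)
  case 0
  then show ?case by (simp add: full_starts_def)
next
  case (Suc n)
  have "0 \<in> full_starts \<beta> 1"
  proof -
    have "beta_transform \<beta> (u / \<beta>) = u" if "u \<in> {0..<1}" for u
      using that beta by (intro beta_transform_eqI[where k = 0]) auto
    moreover have "u / \<beta> < 1" if "u \<in> {0..<1}" for u
      using that beta by simp
    ultimately show ?thesis using beta by (auto simp: full_starts_def)
  qed
  from full_starts_add[OF this Suc.IH] show ?case by simp
qed

lemma full_starts_mono:
  assumes "v \<in> full_starts \<beta> j" "j \<le> n"
  shows "v \<in> full_starts \<beta> n"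
  using full_starts_add[OF assms(1) zero_full_starts[of "n - j"]] assms(2) by simp

lemma full_starts_iterate:
  assumes "v \<in> full_starts \<beta> n" "v \<le> x" "x < v + 1 / \<beta> ^ n"
  shows "(beta_transform \<beta> ^^ n) x = \<beta> ^ n * (x - v)"
proof -
  have "\<beta> ^ n * (x - v) \<in> {0..<1}"
    using assms beta by (simp add: field_simps)
  moreover have "x = v + (\<beta> ^ n * (x - v)) / \<beta> ^ n"
    using beta by simp
  ultimately show ?thesis
    using assms(1) unfolding full_starts_def by fastforce
qed

lemma full_starts_nonneg:
  assumes "v \<in> full_starts \<beta> n"
  shows "0 \<le> v"
proof -
  have "v + 0 / \<beta> ^ n \<in> {0..<1}"
    using assms unfolding full_starts_def by fastforce
  then show ?thesis by simp
qed

lemma full_starts_le: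
  assumes "v \<in> full_starts \<beta> n"
  shows "v + 1 / \<beta> ^ n \<le> 1"
proof (rule field_le_mult_one_interval)
  fix z :: real assume z: "0 < z" "z < 1"
  have "v + z / \<beta> ^ n \<in> {0..<1}"
    using assms z by (auto simp: full_starts_def)
  moreover have "0 \<le> v" by (rule full_starts_nonneg[OF assms])
  moreover have "z * v \<le> v" using z \<open>0 \<le> v\<close> by (simp add: mult_left_le_one_le)
  ultimately show "z * (v + 1 / \<beta> ^ n) \<le> 1"
    by (simp add: distrib_left)
qed

lemma full_starts_unique:
  assumes "v \<in> full_starts \<beta> n" "w \<in> full_starts \<beta> n"
    and "v \<le> x" "x < v + 1 / \<beta> ^ n" "w \<le> x" "x < w + 1 / \<beta> ^ n"
  shows "v = w"
  using full_starts_iterate[OF assms(1,3,4)] full_starts_iterate[OF assms(2,5,6)] beta by simp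

lemma finite_card_full_starts:
  "finite (full_starts \<beta> n) \<and> real (card (full_starts \<beta> n)) \<le> \<beta> ^ n"
proof -
  define f where "f v = nat \<lfloor>\<beta> ^ n * v\<rfloor>" for v
  have pos: "0 < \<beta> ^ n" using beta by simp
  have inj: "inj_on f (full_starts \<beta> n)"
  proof
    fix v w assume v: "v \<in> full_starts \<beta> n" and w: "w \<in> full_starts \<beta> n" and eq: "f v = f w"
    have fl: "\<lfloor>\<beta> ^ n * v\<rfloor> = \<lfloor>\<beta> ^ n * w\<rfloor>"
      using eq full_starts_nonneg[OF v] full_starts_nonneg[OF w] pos by (simp add: f_def eq_nat_nat_iff)
    have "\<beta> ^ n * v < \<beta> ^ n * w + 1" "\<beta> ^ n * w < \<beta> ^ n * v + 1"
      using fl by linarith+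
    then have "\<beta> ^ n * v < \<beta> ^ n * (w + 1 / \<beta> ^ n)" "\<beta> ^ n * w < \<beta> ^ n * (v + 1 / \<beta> ^ n)"
      using beta by (simp_all add: distrib_left)
    then have "v < w + 1 / \<beta> ^ n" "w < v + 1 / \<beta> ^ n"
      using beta by simp_all
    then show "v = w"
      using full_starts_unique[OF v w, of v] full_starts_unique[OF v w, of w] pos
      by (cases "v \<le> w") auto
  qed
  have im: "f ` full_starts \<beta> n \<subseteq> {..<nat \<lfloor>\<beta> ^ n\<rfloor>}"
  proof safe
    fix v assume v: "v \<in> full_starts \<beta> n"
    have "\<beta> ^ n * (v + 1 / \<beta> ^ n) \<le> \<beta> ^ n * 1"
      using full_starts_le[OF v] pos by (intro mult_left_mono) auto
    then have "\<beta> ^ n * v + 1 \<le> \<beta> ^ n"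
      using beta by (simp add: distrib_left)
    then have "\<lfloor>\<beta> ^ n * v\<rfloor> < \<lfloor>\<beta> ^ n\<rfloor>" by linarith
    moreover have "0 \<le> \<lfloor>\<beta> ^ n * v\<rfloor>"
      using full_starts_nonneg[OF v] pos by simp
    ultimately show "f v < nat \<lfloor>\<beta> ^ n\<rfloor>" unfolding f_def by linarith
  qed
  have fin: "finite (full_starts \<beta> n)"
    using im inj finite_subset finite_lessThan finite_imageD by metis
  have "card (full_starts \<beta> n) \<le> nat \<lfloor>\<beta> ^ n\<rfloor>"
    using card_inj_on_le[OF inj im] by simp
  then have "real (card (full_starts \<beta> n)) \<le> \<beta> ^ n"
    using pos by linarith
  with fin show ?thesis by simp
qed

lemma last_cylinder_iterate:
  assumes "1 - one_orbit \<beta> k / \<beta> ^ k \<le> z" "z < 1"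
  shows "(beta_transform \<beta> ^^ k) z = \<beta> ^ k * (z - 1) + one_orbit \<beta> k"
  using assms
proof (induction k)
  case 0
  then show ?case by simp
next
  case (Suc k)
  define c where "c = one_orbit \<beta> k"
  define c' where "c' = one_orbit \<beta> (Suc k)"
  have c': "c' = \<beta> * c - of_int \<lceil>\<beta> * c\<rceil> + 1" by (simp add: c_def c'_def)
  have pos: "0 < \<beta> ^ k" using beta by simp
  have cpos: "0 < c" using one_orbit_range c_def by simp
  have "1 \<le> \<lceil>\<beta> * c\<rceil>" using cpos beta by simp
  then have "c' \<le> \<beta> * c" unfolding c' by linarith
  then have "c' / \<beta> ^ Suc k \<le> c / \<beta> ^ k"
    using pos beta by (simp add: field_simps)
  then have IH: "(beta_transform \<beta> ^^ k) z = \<beta> ^ k * (z - 1) + c"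
    using Suc.IH Suc.prems unfolding c_def[symmetric] c'_def[symmetric] by simp
  have "- c' \<le> \<beta> ^ Suc k * (z - 1)" 
    using Suc.prems pos beta unfolding c'_def[symmetric] by (simp add: field_simps)
  moreover have "\<beta> ^ Suc k * (z - 1) < 0"
    using Suc.prems pos beta by (simp add: mult_pos_neg)
  moreover have "c' \<le> 1" using one_orbit_range c'_def by simp
  ultimately have r: "\<beta> ^ Suc k * (z - 1) + c' \<in> {0..<1}" by simp
  have "beta_transform \<beta> (\<beta> ^ k * (z - 1) + c) = \<beta> ^ Suc k * (z - 1) + c'"
    by (rule beta_transform_eqI[where k = "\<lceil>\<beta> * c\<rceil> - 1", OF _ r])
      (simp add: c' algebra_simps)
  then show ?case by (simp add: IH c'_def)
qed

text \<open>As long as no full cylinder has been passed, the digits of \<open>x\<close> are those of the expansion of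
  \<open>1\<close> from the left: the first smaller digit makes the cylinder full, because then it lies well
  inside the last cylinder of the previous order, on which the iterate is known.\<close>

lemma full_start_or_last_cylinder:
  assumes x: "x \<in> {0..<1}"
  shows "(\<exists>i\<in>{1..k}. cylinder_start \<beta> i x \<in> full_starts \<beta> i) \<or> 1 - one_orbit \<beta> k / \<beta> ^ k \<le> x"
proof (induction k)
  case 0
  then show ?case using x by simp
next
  case (Suc k)
  define c where "c = one_orbit \<beta> k"
  define c' where "c' = one_orbit \<beta> (Suc k)"
  have c': "c' = \<beta> * c - of_int \<lceil>\<beta> * c\<rceil> + 1" by (simp add: c_def c'_def)
  have pos: "0 < \<beta> ^ k" using beta by simp
  show ?case
  proof (cases "\<exists>i\<in>{1..k}. cylinder_start \<beta> i x \<in> full_starts \<beta> i")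
    case True
    then show ?thesis by (meson atLeastAtMost_iff le_SucI)
  next
    case False
    with Suc.IH have xge: "1 - c / \<beta> ^ k \<le> x" by (simp add: c_def)
    show ?thesis
    proof (cases "1 - c' / \<beta> ^ Suc k \<le> x")
      case True
      then show ?thesis by (simp add: c'_def)
    next
      case False
      define u where "u = \<beta> ^ k * (x - 1) + c"
      have u: "(beta_transform \<beta> ^^ k) x = u"
        using last_cylinder_iterate[of k x] xge x by (simp add: c_def u_def)
      define D where "D = \<lfloor>\<beta> * u\<rfloor>"
      have "\<beta> ^ Suc k * (x - 1) < - c'"
        using False pos beta by (simp add: field_simps)
      then have "\<beta> * u < of_int (\<lceil>\<beta> * c\<rceil> - 1)"
        unfolding u_def by (simp add: c' algebra_simps)
      then have "D < \<lceil>\<beta> * c\<rceil> - 1" unfolding D_def by linarith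
      then have Dc: "of_int D + 1 < \<beta> * c" by linarith
      have "0 \<le> u" using funpow_beta_transform_range[OF x, where \<beta> = \<beta> and n = k] u by simp
      then have D0: "0 \<le> D" unfolding D_def using beta by simp
      have start: "cylinder_start \<beta> (Suc k) x = 1 - c / \<beta> ^ k + of_int D / \<beta> ^ Suc k"
      proof -
        have "(beta_transform \<beta> ^^ Suc k) x = \<beta> * u - of_int D"
          using u by (simp add: beta_transform_def D_def)
        then show ?thesis
          using pos beta unfolding cylinder_start_def u_def by (simp add: field_simps)
      qed
      have "1 - c / \<beta> ^ k + of_int D / \<beta> ^ Suc k \<in> full_starts \<beta> (Suc k)"
        unfolding full_starts_def
      proof (intro CollectI ballI)
        fix r :: real assume r: "r \<in> {0..<1}"
        define z where "z = 1 - c / \<beta> ^ k + of_int D / \<beta> ^ Suc k + r / \<beta> ^ Suc k"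
        have z: "z = 1 - c / \<beta> ^ k + (of_int D + r) / \<beta> ^ Suc k"
          by (simp add: z_def add_divide_distrib)
        have z1: "1 - c / \<beta> ^ k \<le> z"
          unfolding z using D0 r beta by simp
        have "(of_int D + r) / \<beta> ^ Suc k < c / \<beta> ^ k"
        proof -
          have "of_int D + r < \<beta> * c" using Dc r by simp
          then have "(of_int D + r) / \<beta> ^ Suc k < (\<beta> * c) / \<beta> ^ Suc k"
            using beta by (intro divide_strict_right_mono) auto
          then show ?thesis using beta by simp
        qed
        then have z2: "z < 1" unfolding z by simp
        have "c / \<beta> ^ k \<le> 1"
        proof -
          have "c \<le> 1" using one_orbit_range c_def by simp
          also have "1 \<le> \<beta> ^ k" using beta by simp
          finally show ?thesis using pos by simp
        qed
        then have z0: "0 \<le> z" using z1 by simp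
        have "(beta_transform \<beta> ^^ k) z = \<beta> ^ k * (z - 1) + c"
          using last_cylinder_iterate[of k z] z1 z2 by (simp add: c_def)
        also have "\<dots> = (of_int D + r) / \<beta>"
          unfolding z using pos beta by (simp add: field_simps)
        finally have "(beta_transform \<beta> ^^ Suc k) z = beta_transform \<beta> ((of_int D + r) / \<beta>)"
          by simp
        also have "\<dots> = r"
          using r beta by (intro beta_transform_eqI[where k = D]) auto
        finally show "z \<in> {0..<1} \<and> (beta_transform \<beta> ^^ Suc k) z = r"
          using z0 z2 by simp
      qed
      with start have "cylinder_start \<beta> (Suc k) x \<in> full_starts \<beta> (Suc k)" by simp
      then show ?thesis by (intro disjI1 bexI[of _ "Suc k"]) auto
    qed
  qed
qed

text \<open>Every cylinder of order \<open>n\<close> is the last one inside a full cylinder of some order \<open>j \<le> n\<close>: split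
  off full prefixes as long as possible.\<close>

lemma last_cylinder_in_full:
  assumes "x \<in> {0..<1}"
  obtains j v where "j \<le> n" "v \<in> full_starts \<beta> j" "x < v + 1 / \<beta> ^ j"
    "v + 1 / \<beta> ^ j - one_orbit \<beta> (n - j) / \<beta> ^ n \<le> x"
proof -
  have "\<exists>j v. j \<le> n \<and> v \<in> full_starts \<beta> j \<and> x < v + 1 / \<beta> ^ j \<and>
    v + 1 / \<beta> ^ j - one_orbit \<beta> (n - j) / \<beta> ^ n \<le> x"
    using assms
  proof (induction n arbitrary: x rule: less_induct)
    case (less n)
    show ?case
    proof (cases "1 - one_orbit \<beta> n / \<beta> ^ n \<le> x")
      case True
      then show ?thesis
        using less.prems zero_full_starts[of 0] by (intro exI[of _ 0]) auto
    next
      case False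
      then obtain i where i: "1 \<le> i" "i \<le> n" "cylinder_start \<beta> i x \<in> full_starts \<beta> i"
        using full_start_or_last_cylinder[OF less.prems, of n] by auto
      define y where "y = (beta_transform \<beta> ^^ i) x"
      have x: "x = cylinder_start \<beta> i x + y / \<beta> ^ i"
        by (simp add: cylinder_start_def y_def)
      have "y \<in> {0..<1}"
        unfolding y_def by (rule funpow_beta_transform_range[OF less.prems])
      then obtain j v where jv: "j \<le> n - i" "v \<in> full_starts \<beta> j" "y < v + 1 / \<beta> ^ j"
        "v + 1 / \<beta> ^ j - one_orbit \<beta> (n - i - j) / \<beta> ^ (n - i) \<le> y"
        using less.IH[of "n - i" y] i by auto
      have pos: "0 < \<beta> ^ i" using beta by simp
      let ?w = "cylinder_start \<beta> i x + v / \<beta> ^ i"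
      have w: "?w \<in> full_starts \<beta> (i + j)"
        by (rule full_starts_add[OF i(3) jv(2)])
      have split: "\<beta> ^ n = \<beta> ^ (n - i) * \<beta> ^ i"
        using i by (simp flip: power_add)
      have up: "x < ?w + 1 / \<beta> ^ (i + j)"
      proof -
        have "y / \<beta> ^ i < (v + 1 / \<beta> ^ j) / \<beta> ^ i"
          using jv(3) pos by (rule divide_strict_right_mono)
        also have "\<dots> = v / \<beta> ^ i + 1 / \<beta> ^ (i + j)"
          by (simp add: add_divide_distrib power_add mult.commute)
        finally show ?thesis using x by linarith
      qed
      have lo: "?w + 1 / \<beta> ^ (i + j) - one_orbit \<beta> (n - (i + j)) / \<beta> ^ n \<le> x"
      proof -
        have "(v + 1 / \<beta> ^ j - one_orbit \<beta> (n - i - j) / \<beta> ^ (n - i)) / \<beta> ^ i \<le> y / \<beta> ^ i"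
          using jv(4) pos by (intro divide_right_mono) auto
        also have "(v + 1 / \<beta> ^ j - one_orbit \<beta> (n - i - j) / \<beta> ^ (n - i)) / \<beta> ^ i =
          v / \<beta> ^ i + 1 / \<beta> ^ (i + j) - one_orbit \<beta> (n - (i + j)) / \<beta> ^ n"
          by (simp add: add_divide_distrib diff_divide_distrib power_add split mult.commute)
        finally show ?thesis using x by linarith
      qed
      have "i + j \<le> n" using jv(1) i by simp
      with w up lo show ?thesis by blast
    qed
  qed
  then show ?thesis using that by blast
qed

text \<open>Renyi's bound for the number of cylinders of order \<open>n\<close>. Each of them is determined by the full
  cylinder in which it is the last one.\<close>

lemma card_cylinder_starts:
  "finite (cylinder_start \<beta> n ` {0..<1}) \<and>
   real (card (cylinder_start \<beta> n ` {0..<1})) \<le> \<beta> / (\<beta> - 1) * \<beta> ^ n"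
proof -
  define f where "f j v = v + 1 / \<beta> ^ j - one_orbit \<beta> (n - j) / \<beta> ^ n" for j v
  have sub: "cylinder_start \<beta> n ` {0..<1} \<subseteq> (\<Union>j\<in>{..n}. f j ` full_starts \<beta> j)"
  proof
    fix y assume "y \<in> cylinder_start \<beta> n ` {0..<1}"
    then obtain x where x: "x \<in> {0..<1}" and y: "y = cylinder_start \<beta> n x" by auto
    from last_cylinder_in_full[OF x, of n] obtain j v where
      jv: "j \<le> n" "v \<in> full_starts \<beta> j" "x < v + 1 / \<beta> ^ j"
      "v + 1 / \<beta> ^ j - one_orbit \<beta> (n - j) / \<beta> ^ n \<le> x" by blast
    have pos: "0 < \<beta> ^ j" "0 < \<beta> ^ n" using beta by simp_all
    have split: "\<beta> ^ n = \<beta> ^ (n - j) * \<beta> ^ j" using jv(1) by (simp flip: power_add)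
    have "one_orbit \<beta> (n - j) / \<beta> ^ n \<le> 1 / \<beta> ^ j"
    proof (rule frac_le)
      show "\<beta> ^ j \<le> \<beta> ^ n" using jv(1) beta by (intro power_increasing) auto
    qed (use one_orbit_range pos in auto)
    then have "v \<le> x" using jv(4) by linarith
    then have it: "(beta_transform \<beta> ^^ j) x = \<beta> ^ j * (x - v)"
      using full_starts_iterate jv by blast
    define u where "u = \<beta> ^ j * (x - v)"
    have "u < \<beta> ^ j * (1 / \<beta> ^ j)"
      unfolding u_def using jv(3) pos by (intro mult_strict_left_mono) auto
    then have "u < 1" using beta by simp
    moreover have "1 - one_orbit \<beta> (n - j) / \<beta> ^ (n - j) \<le> u"
    proof -
      have "\<beta> ^ j * (1 / \<beta> ^ j - one_orbit \<beta> (n - j) / \<beta> ^ n) \<le> u"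
        unfolding u_def using jv(4) pos by (intro mult_left_mono) auto
      then show ?thesis using beta by (simp add: right_diff_distrib split)
    qed
    ultimately have "(beta_transform \<beta> ^^ (n - j)) u = \<beta> ^ (n - j) * (u - 1) + one_orbit \<beta> (n - j)"
      by (intro last_cylinder_iterate)
    then have "(beta_transform \<beta> ^^ n) x = \<beta> ^ (n - j) * (u - 1) + one_orbit \<beta> (n - j)"
      using it jv(1) funpow_add[of "n - j" j "beta_transform \<beta>"] by (simp add: u_def)
    then have "(beta_transform \<beta> ^^ n) x =
        \<beta> ^ n * (x - v - 1 / \<beta> ^ j + one_orbit \<beta> (n - j) / \<beta> ^ n)"
      unfolding u_def split using beta by (simp add: algebra_simps)
    then have "y = f j v"
      unfolding y cylinder_start_def f_def using beta by simp
    then show "y \<in> (\<Union>j\<in>{..n}. f j ` full_starts \<beta> j)" using jv by blast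
  qed
  have fin: "finite (f j ` full_starts \<beta> j)" for j
    using finite_card_full_starts by simp
  then have finU: "finite (\<Union>j\<in>{..n}. f j ` full_starts \<beta> j)" by blast
  have "card (cylinder_start \<beta> n ` {0..<1}) \<le> card (\<Union>j\<in>{..n}. f j ` full_starts \<beta> j)"
    using sub finU by (rule card_mono[rotated])
  also have "\<dots> \<le> (\<Sum>j\<in>{..n}. card (f j ` full_starts \<beta> j))"
    by (rule card_UN_le) simp
  also have "\<dots> \<le> (\<Sum>j\<in>{..n}. card (full_starts \<beta> j))"
    using finite_card_full_starts by (intro sum_mono card_image_le) blast
  finally have "real (card (cylinder_start \<beta> n ` {0..<1})) \<le> (\<Sum>j\<in>{..n}. real (card (full_starts \<beta> j)))"
    by (simp flip: of_nat_sum)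
  also have "\<dots> \<le> (\<Sum>j\<in>{..n}. \<beta> ^ j)"
    using finite_card_full_starts by (intro sum_mono) blast
  also have "\<dots> = (\<beta> ^ Suc n - 1) / (\<beta> - 1)"
    using geometric_sum[of \<beta> "Suc n"] beta by (simp add: lessThan_Suc_atMost)
  also have "\<dots> \<le> \<beta> / (\<beta> - 1) * \<beta> ^ n"
    using beta by (simp add: divide_right_mono)
  finally show ?thesis using sub finU finite_subset by blast
qed

text \<open>If \<open>[a, a + h)\<close> contained no full cylinder of order \<open>n\<close>, then it would contain none of any lower
  order either, so for each \<open>j \<le> n\<close> it would meet at most two full cylinders of order \<open>j\<close>, those
  around its endpoints. As every point is within \<open>\<beta>\<^sup>-\<^sup>n\<close> of the right end of a full cylinder of some
  order \<open>j \<le> n\<close>, the interval would be short.\<close>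

lemma full_cylinder_in_interval:
  assumes a: "0 \<le> a" "a + h \<le> 1" and h: "2 * (real n + 1) / \<beta> ^ n < h"
  obtains v where "v \<in> full_starts \<beta> n" "a \<le> v" "v + 1 / \<beta> ^ n \<le> a + h"
proof (rule ccontr)
  assume "\<not> thesis"
  with that have no: "v \<in> full_starts \<beta> n \<Longrightarrow> \<not> (a \<le> v \<and> v + 1 / \<beta> ^ n \<le> a + h)" for v
    by blast
  define B where
    "B j = {v \<in> full_starts \<beta> j. \<exists>x\<in>{a..<a + h}. v \<le> x \<and> x < v + 1 / \<beta> ^ j}" for j
  define J where "J j v = {v + 1 / \<beta> ^ j - 1 / \<beta> ^ n ..< v + 1 / \<beta> ^ j}" for j v
  have pos: "0 < \<beta> ^ j" for j using beta by simp
  have le: "1 / \<beta> ^ n \<le> 1 / \<beta> ^ j" if "j \<le> n" for j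
    using that beta by (intro frac_le power_increasing) auto
  have finB: "finite (B j)" for j
    unfolding B_def using finite_card_full_starts by (metis (no_types) finite_Collect_conjI Collect_mem_eq)
  have cardB: "card (B j) \<le> 2" if "j \<le> n" for j
  proof -
    have ends: "(v \<le> a \<and> a < v + 1 / \<beta> ^ j) \<or> (v \<le> a + h \<and> a + h < v + 1 / \<beta> ^ j)" if v: "v \<in> B j" for v
    proof -
      have "v \<in> full_starts \<beta> n"
        using v \<open>j \<le> n\<close> full_starts_mono by (auto simp: B_def)
      then have "v < a \<or> a + h < v + 1 / \<beta> ^ j"
        using no le[OF \<open>j \<le> n\<close>] by fastforce
      then show ?thesis using v by (auto simp: B_def)
    qed
    have "B j \<subseteq> {v \<in> full_starts \<beta> j. v \<le> a \<and> a < v + 1 / \<beta> ^ j} \<union>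
        {v \<in> full_starts \<beta> j. v \<le> a + h \<and> a + h < v + 1 / \<beta> ^ j}" (is "_ \<subseteq> ?P \<union> ?Q")
      using ends by (auto simp: B_def)
    moreover have "finite ?P" "finite ?Q" using finite_card_full_starts by auto
    moreover have "card ?P \<le> 1" "card ?Q \<le> 1"
      using full_starts_unique by (auto simp: card_le_Suc0_iff_eq finite_card_full_starts)
    ultimately show ?thesis
      using card_mono[of "?P \<union> ?Q" "B j"] card_Un_le[of ?P ?Q] by simp
  qed
  have cover: "{a..<a + h} \<subseteq> (\<Union>(j, v)\<in>Sigma {..n} B. J j v)"
  proof
    fix x assume x: "x \<in> {a..<a + h}"
    then have x01: "x \<in> {0..<1}" using a by simp
    from last_cylinder_in_full[OF x01, of n] obtain j v where
      jv: "j \<le> n" "v \<in> full_starts \<beta> j" "x < v + 1 / \<beta> ^ j"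
      "v + 1 / \<beta> ^ j - one_orbit \<beta> (n - j) / \<beta> ^ n \<le> x" by blast
    have "one_orbit \<beta> (n - j) / \<beta> ^ n \<le> 1 / \<beta> ^ n"
      using one_orbit_range[of \<beta> "n - j"] beta by (intro divide_right_mono) auto
    then have xJ: "x \<in> J j v" using jv by (simp add: J_def)
    then have "v \<le> x" using le[OF jv(1)] by (simp add: J_def)
    then have "v \<in> B j" using jv x by (auto simp: B_def)
    then show "x \<in> (\<Union>(j, v)\<in>Sigma {..n} B. J j v)" using xJ jv(1) by blast
  qed
  have fin: "finite (Sigma {..n} B)" using finB by blast
  have "0 < h" using h pos[of n] by (smt (verit) divide_nonneg_pos of_nat_0_le_iff)
  then have "h = measure lborel {a..<a + h}" by simp
  also have "\<dots> \<le> measure lborel (\<Union>(j, v)\<in>Sigma {..n} B. J j v)"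
    using fin by (intro measure_mono_fmeasurable cover fmeasurable.finite_UN) (auto simp: J_def fmeasurable_def pos less_imp_le)
  also have "\<dots> \<le> (\<Sum>(j, v)\<in>Sigma {..n} B. measure lborel (J j v))"
    using measure_UNION_le[OF fin, of "\<lambda>(j, v). J j v" lborel] by (simp add: J_def case_prod_beta)
  also have "\<dots> = (\<Sum>(j, v)\<in>Sigma {..n} B. 1 / \<beta> ^ n)"
    by (intro sum.cong) (auto simp: J_def pos less_imp_le)
  also have "\<dots> = (\<Sum>j\<in>{..n}. real (card (B j)) / \<beta> ^ n)"
    using finB by (simp add: card_SigmaI sum_divide_distrib)
  also have "\<dots> \<le> (\<Sum>j\<in>{..n}. 2 / \<beta> ^ n)"
    using cardB pos by (intro sum_mono divide_right_mono) (auto simp: less_imp_le)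
  also have "\<dots> = 2 * (real n + 1) / \<beta> ^ n" by simp
  finally show False using h by simp
qed

end

section \<open>Hoelder parametrization of limsup sets\<close>

text \<open>The construction of \<open>\<gamma>\<close>. At stage \<open>k\<close> there are \<open>Q k\<close> intervals of length \<open>h k\<close>, one for each
  value of \<open>\<lfloor>Q k * t\<rfloor>\<close>. Each is divided into \<open>N k\<close> pieces of equal length, and in the left half of each
  piece an interval of length \<open>h (k + 1)\<close> inside the next target set is chosen. As the pieces are
  equally spaced, all the mass estimates reduce to the one condition \<open>1 \<le> Q k * h k powr \<theta>\<close>.\<close>

locale nested_selection =
  fixes N Q :: "nat \<Rightarrow> nat" and h :: "nat \<Rightarrow> real" and sel :: "nat \<Rightarrow> real \<Rightarrow> real" and \<theta> :: real
  assumes N_ge: "\<And>k. 2 \<le> N k"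
    and h_pos: "\<And>k. 0 < h k"
    and h_0: "h 0 = 1"
    and Q_0: "Q 0 = 1"
    and Q_Suc: "\<And>k. Q (Suc k) = Q k * N k"
    and Q_h: "\<And>k. 1 \<le> real (Q k) * h k powr \<theta>"
    and sel_ge: "\<And>k a. 0 \<le> a \<Longrightarrow> a + h k / N k / 2 \<le> 1 \<Longrightarrow> a \<le> sel k a"
    and sel_le: "\<And>k a. 0 \<le> a \<Longrightarrow> a + h k / N k / 2 \<le> 1 \<Longrightarrow>
        sel k a + h (Suc k) \<le> a + h k / N k / 2"
    and theta: "0 < \<theta>" "\<theta> \<le> 1"
begin

definition index :: "nat \<Rightarrow> real \<Rightarrow> nat" where
  "index k t = nat \<lfloor>real (Q k) * t\<rfloor>"

definition digit :: "nat \<Rightarrow> real \<Rightarrow> nat" where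
  "digit k t = index (Suc k) t mod N k"

definition width :: "nat \<Rightarrow> real" where
  "width k = h k / N k"

primrec node :: "nat \<Rightarrow> real \<Rightarrow> real" where
  "node 0 t = 0"
| "node (Suc k) t = sel k (node k t + digit k t * width k)"

definition limit_point :: "real \<Rightarrow> real" where
  "limit_point t = (SUP k. node k t)"

lemma N_pos: "0 < N k"
  using N_ge[of k] by simp

lemma Q_ge: "2 ^ k \<le> Q k"
proof (induction k)
  case (Suc k)
  then show ?case
    using mult_mono[OF Suc.IH N_ge[of k]] by (simp add: Q_Suc mult.commute)
qed (simp add: Q_0)

lemma Q_pos: "0 < Q k"
  using less_le_trans[OF _ Q_ge[of k]] by simp

lemma index_bounds:
  fixes t :: real
  assumes "0 \<le> t"
  shows "index k t \<le> Q k * t" "Q k * t < real (index k t) + 1"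
proof -
  have "0 \<le> Q k * t" using assms by simp
  then have "real (index k t) = of_int \<lfloor>Q k * t\<rfloor>"
    by (simp add: index_def)
  then show "index k t \<le> Q k * t" "Q k * t < real (index k t) + 1"
    by linarith+
qed

lemma index_Suc_div:
  assumes "0 \<le> t"
  shows "index (Suc k) t div N k = index k t"
proof (rule div_nat_eqI)
  have "real (index k t * N k) \<le> Q (Suc k) * t"
    using mult_right_mono[OF index_bounds(1)[OF assms, of k], of "real (N k)"]
    by (simp add: Q_Suc mult_ac)
  then have "real (index k t * N k) < real (index (Suc k) t + 1)"
    using index_bounds(2)[OF assms, of "Suc k"] by linarith
  then show "N k * index k t \<le> index (Suc k) t"
    by (simp only: of_nat_less_iff) (simp add: mult.commute)
  have "Q (Suc k) * t < (index k t + 1) * N k"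
    using mult_strict_right_mono[OF index_bounds(2)[OF assms, of k], of "real (N k)"] N_pos[of k]
    by (simp add: Q_Suc algebra_simps)
  then have "real (index (Suc k) t) < real ((index k t + 1) * N k)"
    using index_bounds(1)[OF assms, of "Suc k"] by linarith
  then show "index (Suc k) t < N k * Suc (index k t)" 
    by (simp only: of_nat_less_iff) (simp add: mult.commute)
qed

lemma index_Suc:
  assumes "0 \<le> t"
  shows "index (Suc k) t = index k t * N k + digit k t"
  using div_mult_mod_eq[of "index (Suc k) t" "N k"]
  by (simp add: digit_def index_Suc_div[OF assms])

lemma digit_less: "digit k t < N k"
  using N_pos by (simp add: digit_def)

lemma node_cong:
  assumes "0 \<le> s" "0 \<le> t" "index k s = index k t"
  shows "node k s = node k t"
  using assms(3)
proof (induction k)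
  case (Suc k)
  have "index k s = index k t"
    using Suc.prems index_Suc_div assms by metis
  moreover have "digit k s = digit k t"
    using Suc.prems by (simp add: digit_def)
  ultimately show ?case using Suc.IH by simp
qed simp

lemma width_pos: "0 < width k"
  using h_pos N_pos by (simp add: width_def)

lemma N_width: "N k * width k = h k"
  using N_pos[of k] by (simp add: width_def)

lemma piece_le: "node k t + digit k t * width k + width k \<le> node k t + h k"
proof -
  have "(real (digit k t) + 1) * width k \<le> N k * width k"
    using digit_less[of k t] width_pos[of k] by (intro mult_right_mono) auto
  then show ?thesis by (simp add: N_width algebra_simps)
qed

lemma node_Suc_range_if:
  assumes "0 \<le> node k t" "node k t + h k \<le> 1"
  shows "node k t + digit k t * width k \<le> node (Suc k) t"
    and "node (Suc k) t + h (Suc k) \<le> node k t + digit k t * width k + width k / 2"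
proof -
  have "0 \<le> digit k t * width k" using width_pos[of k] by simp
  then have "0 \<le> node k t + digit k t * width k" using assms by linarith
  moreover have "node k t + digit k t * width k + width k / 2 \<le> 1"
    using piece_le[of k t] width_pos[of k] assms by linarith
  ultimately show "node k t + digit k t * width k \<le> node (Suc k) t"
    "node (Suc k) t + h (Suc k) \<le> node k t + digit k t * width k + width k / 2"
    using sel_ge sel_le by (simp_all add: width_def)
qed

lemma node_range: "0 \<le> node k t \<and> node k t + h k \<le> 1"
proof (induction k)
  case (Suc k)
  have "0 \<le> digit k t * width k" using width_pos[of k] by simp
  then show ?case
    using node_Suc_range_if[of k t] Suc.IH piece_le[of k t] width_pos[of k]
    by (intro conjI; linarith)
qed (simp add: h_0)

lemmas node_Suc_range =
  node_Suc_range_if[OF node_range[THEN conjunct1] node_range[THEN conjunct2]]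

lemma node_nested:
  assumes "k \<le> j"
  shows "node k t \<le> node j t \<and> node j t + h j \<le> node k t + h k"
  using assms
proof (induction j rule: dec_induct)
  case (step j)
  have "0 \<le> digit j t * width j" "0 \<le> width j / 2"
    using width_pos[of j] by simp_all
  then show ?case
    using step.IH node_Suc_range[of j t] piece_le[of j t]
    by (intro conjI; linarith)
qed simp

lemma limit_point_range: "node k t \<le> limit_point t \<and> limit_point t \<le> node k t + h k"
proof
  have le: "node j t \<le> node k t + h k" for j k
  proof (cases "k \<le> j")
    case True
    then show ?thesis using node_nested[of k j t] h_pos[of j] by linarith
  next
    case False
    then show ?thesis using node_nested[of j k t] h_pos[of k] by linarith
  qed
  show "node k t \<le> limit_point t"
    unfolding limit_point_def using le[of _ 0] by (intro cSUP_upper bdd_aboveI2) auto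
  show "limit_point t \<le> node k t + h k"
    unfolding limit_point_def using le by (intro cSUP_least) auto
qed

lemma limit_point_range_01: "limit_point t \<in> {0..<1}"
proof -
  have "0 < width 0 / 2" using width_pos[of 0] by simp
  moreover have "limit_point t \<le> node (Suc 0) t + h (Suc 0)"
    using limit_point_range[of "Suc 0" t] by simp
  ultimately have "limit_point t < node 0 t + h 0"
    using node_Suc_range[of 0 t] piece_le[of 0 t] by linarith
  then show ?thesis
    using limit_point_range[of 0 t] node_range[of 0 t] by simp
qed

text \<open>At the first stage \<open>k + 1\<close> where \<open>s\<close> and \<open>t\<close> are separated, their nodes lie in different pieces
  of one interval of stage \<open>k\<close>. Both \<open>|s - t|\<close> and the distance of the limit points are then
  comparable to the number \<open>D\<close> of pieces between them, measured in units of \<open>1 / (Q k * N k)\<close> and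
  of \<open>width k\<close>.\<close>

lemma limit_point_expanding_less:
  assumes "0 \<le> s" "s < t" "t < 1"
  shows "t - s \<le> 4 * \<bar>limit_point t - limit_point s\<bar> powr \<theta>"
proof -
  have "\<exists>k. index k s \<noteq> index k t"
  proof -
    obtain k where "1 / (t - s) < 2 ^ k"
      using real_arch_pow[of 2 "1 / (t - s)"] by auto
    also have "2 ^ k \<le> real (Q k)"
      using Q_ge[of k] by (metis of_nat_le_iff of_nat_numeral of_nat_power)
    finally have "1 < Q k * (t - s)" using assms by (simp add: field_simps)
    then have "Q k * s + 1 < Q k * t" by (simp add: algebra_simps)
    then have "real (index k s) \<noteq> real (index k t)"
      using index_bounds[of s k] index_bounds[of t k] assms by linarith
    then have "index k s \<noteq> index k t" by simp
    then show ?thesis ..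
  qed
  then obtain k where k: "index k s \<noteq> index k t" "\<And>j. j < k \<Longrightarrow> index j s = index j t"
    using exists_least_iff[of "\<lambda>k. index k s \<noteq> index k t"] by blast
  have "real (index 0 s) < 1" "real (index 0 t) < 1"
    using index_bounds(1)[of s 0] index_bounds(1)[of t 0] assms by (simp_all add: Q_0)
  then have "index 0 s = index 0 t" by simp
  with k obtain m where m: "k = Suc m" by (cases k) auto
  have node: "node m s = node m t"
    using k(2)[of m] m assms by (intro node_cong) auto
  have Q: "0 < real (Q k)" using Q_pos by simp
  have "Q k * s < Q k * t" using assms Q by simp
  then have "real (index k s) < index k t + 1"
    using index_bounds[of s k] index_bounds[of t k] assms by linarith
  then have "index k s < index k t" using k(1) by simp
  then have less: "digit m s < digit m t"
    using index_Suc[of s m] index_Suc[of t m] k(2)[of m] m assms by simp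
  define D where "D = real (digit m t) - real (digit m s)"
  have D1: "1 \<le> D" using less by (simp add: D_def)
  have Nm: "0 < real (N m)" using N_pos by simp
  have DN: "D \<le> N m" using digit_less[of m t] by (simp add: D_def)
  have "Q k * t - Q k * s < real (index k t) + 1 - index k s"
    using index_bounds[of s k] index_bounds[of t k] assms by linarith
  also have "\<dots> = D + 1"
    using index_Suc[of s m] index_Suc[of t m] k(2)[of m] m assms by (simp add: D_def)
  finally have "Q k * (t - s) \<le> 2 * D" using D1 by (simp add: algebra_simps)
  then have ts: "t - s \<le> 2 * D / Q k" using Q by (simp add: field_simps)
  define \<Delta> where "\<Delta> = limit_point t - limit_point s"
  have "D * width m - width m / 2 \<le> \<Delta>"
  proof -
    have "limit_point s \<le> node m s + digit m s * width m + width m / 2"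
      using limit_point_range[of k s] node_Suc_range[of m s] m by simp
    moreover have "node m t + digit m t * width m \<le> limit_point t"
      using limit_point_range[of k t] node_Suc_range[of m t] m by simp
    ultimately show ?thesis
      unfolding \<Delta>_def D_def left_diff_distrib using node by linarith
  qed
  moreover have "width m \<le> D * width m"
    using mult_right_mono[OF D1, of "width m"] width_pos[of m] by simp
  ultimately have Dh: "D * width m \<le> 2 * \<Delta>"
    by linarith
  have "D / N m \<le> (D / N m) powr \<theta>"
  proof -
    have "0 < D / N m" "D / N m \<le> 1" using D1 DN Nm by simp_all
    then show ?thesis using powr_mono'[of \<theta> 1 "D / N m"] theta D1 by simp
  qed
  moreover have "1 / Q m \<le> h m powr \<theta>"
    using Q_h[of m] Q_pos[of m] by (simp add: field_simps)
  ultimately have "D / N m * (1 / Q m) \<le> (D / N m) powr \<theta> * h m powr \<theta>"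
    using D1 Nm by (intro mult_mono) auto
  also have "\<dots> = (D * width m) powr \<theta>"
    using D1 Nm h_pos[of m] by (subst powr_mult[symmetric]) (auto simp: width_def)
  also have "\<dots> \<le> (2 * \<Delta>) powr \<theta>"
    using Dh D1 width_pos[of m] Nm theta by (intro powr_mono2) auto
  also have "\<dots> = 2 powr \<theta> * \<bar>\<Delta>\<bar> powr \<theta>"
  proof -
    have "0 \<le> D * width m" using D1 width_pos[of m] by simp
    then have "0 \<le> \<Delta>" using Dh by linarith
    then show ?thesis by (simp add: powr_mult)
  qed
  also have "\<dots> \<le> 2 * \<bar>\<Delta>\<bar> powr \<theta>"
    using powr_mono[of \<theta> 1 2] theta by (intro mult_right_mono) auto
  finally have "D / Q k \<le> 2 * \<bar>\<Delta>\<bar> powr \<theta>"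
    using Q_Suc[of m] m by (simp add: mult.commute)
  then show ?thesis using ts unfolding \<Delta>_def by linarith
qed

lemma limit_point_expanding:
  assumes "s \<in> {0..<1}" "t \<in> {0..<1}"
  shows "\<bar>s - t\<bar> \<le> 4 * \<bar>limit_point s - limit_point t\<bar> powr \<theta>"
proof (cases s t rule: linorder_cases)
  case less
  then have "\<bar>s - t\<bar> = t - s" by simp
  also have "\<dots> \<le> 4 * \<bar>limit_point t - limit_point s\<bar> powr \<theta>"
    using less assms by (intro limit_point_expanding_less) auto
  finally show ?thesis by (simp only: abs_minus_commute)
next
  case greater
  then have "\<bar>s - t\<bar> = s - t" by simp
  also have "\<dots> \<le> 4 * \<bar>limit_point s - limit_point t\<bar> powr \<theta>"
    using greater assms by (intro limit_point_expanding_less) auto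
  finally show ?thesis .
qed simp

end

text \<open>The stages are chosen greedily: given \<open>Q k\<close> and \<open>h k\<close>, any sufficiently large \<open>n\<close> for which
  \<open>\<sigma>\<close> is small against \<open>\<eta> powr \<theta>\<close> gives \<open>Q (k + 1) * h (k + 1) powr \<theta> \<ge> 1\<close>, because
  \<open>Q (k + 1)\<close> is about \<open>Q k * h k / (2 * \<sigma>)\<close> and \<open>h (k + 1) = \<eta>\<close>.\<close>

lemma expanding_map_into_limsup:
  fixes E :: "nat \<Rightarrow> real set" and \<theta> :: real
  assumes theta: "0 < \<theta>" "\<theta> \<le> 1"
    and hit: "\<And>\<epsilon> n0. 0 < \<epsilon> \<Longrightarrow> \<exists>n\<ge>n0. \<exists>\<sigma> \<eta>. 0 < \<sigma> \<and> 0 < \<eta> \<and> \<eta> \<le> 1 \<and> \<sigma> < \<epsilon> * \<eta> powr \<theta> \<and>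
       (\<forall>a. 0 \<le> a \<and> a + \<sigma> \<le> 1 \<longrightarrow> (\<exists>y. a \<le> y \<and> y + \<eta> \<le> a + \<sigma> \<and> {y..y + \<eta>} \<subseteq> E n))"
  obtains \<gamma> :: "real \<Rightarrow> real" where
    "\<And>t. t \<in> {0..<1} \<Longrightarrow> \<gamma> t \<in> {0..<1}"
    "\<And>t. t \<in> {0..<1} \<Longrightarrow> \<exists>\<^sub>\<infinity>n. \<gamma> t \<in> E n"
    "\<And>s t. s \<in> {0..<1} \<Longrightarrow> t \<in> {0..<1} \<Longrightarrow> \<bar>s - t\<bar> \<le> 4 * \<bar>\<gamma> s - \<gamma> t\<bar> powr \<theta>"
proof -
  define good :: "nat \<Rightarrow> real \<Rightarrow> nat \<Rightarrow> real \<Rightarrow> bool" where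
    "good n l N h' \<longleftrightarrow> 2 \<le> N \<and>
       (\<forall>a. 0 \<le> a \<and> a + l / N / 2 \<le> 1 \<longrightarrow>
          (\<exists>y. a \<le> y \<and> y + h' \<le> a + l / N / 2 \<and> {y..y + h'} \<subseteq> E n))" for n l N h'
  have step: "\<exists>n h' N. n0 < n \<and> 0 < h' \<and> 1 \<le> real (Q * N) * h' powr \<theta> \<and> good n l N h'"
    if l: "0 < l" and Q: "0 < Q" for n0 Q :: nat and l :: real
  proof -
    \<comment> \<open>\<open>\<sigma> < l / 4\<close> gives at least two pieces, \<open>\<sigma> < Q * l / 4 * \<eta> powr \<theta>\<close> the bound on \<open>Q * N * \<eta> powr \<theta>\<close>\<close>
    define \<epsilon> where "\<epsilon> = min (l / 4) (Q * l / 4)"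
    have "0 < \<epsilon>" using l Q by (simp add: \<epsilon>_def)
    from hit[OF this, of "Suc n0"] obtain n \<sigma> \<eta> where n: "Suc n0 \<le> n"
      and \<sigma>: "0 < \<sigma>" and \<eta>: "0 < \<eta>" "\<eta> \<le> 1" and small: "\<sigma> < \<epsilon> * \<eta> powr \<theta>"
      and H: "\<And>a. 0 \<le> a \<Longrightarrow> a + \<sigma> \<le> 1 \<Longrightarrow> \<exists>y. a \<le> y \<and> y + \<eta> \<le> a + \<sigma> \<and> {y..y + \<eta>} \<subseteq> E n"
      by metis
    define N where "N = nat \<lfloor>l / (2 * \<sigma>)\<rfloor>"
    have "\<eta> powr \<theta> \<le> 1" using \<eta> theta by (intro powr_le1) auto
    then have "\<epsilon> * \<eta> powr \<theta> \<le> \<epsilon>" using \<open>0 < \<epsilon>\<close> by (simp add: mult_left_le)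
    then have "\<sigma> < l / 4" using small by (simp add: \<epsilon>_def)
    then have 2: "2 < l / (2 * \<sigma>)" using \<sigma> by (simp add: field_simps)
    have N2: "2 \<le> N" unfolding N_def using 2 by (simp add: le_nat_iff le_floor_iff)
    have N_le: "N \<le> l / (2 * \<sigma>)" unfolding N_def using 2 by linarith
    have N_ge: "l / (4 * \<sigma>) \<le> N"
    proof -
      have "l / (2 * \<sigma>) < real N + 1" unfolding N_def using 2 by linarith
      moreover have "l / (2 * \<sigma>) = 2 * (l / (4 * \<sigma>))" by simp
      ultimately show ?thesis using 2 by linarith
    qed
    have "1 \<le> real (Q * N) * \<eta> powr \<theta>"
    proof -
      have "\<sigma> < (Q * l / 4) * \<eta> powr \<theta>"
        by (rule less_le_trans[OF small], rule mult_right_mono) (auto simp: \<epsilon>_def)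
      then have "1 \<le> Q * (l / (4 * \<sigma>)) * \<eta> powr \<theta>"
        using \<sigma> by (simp add: field_simps)
      also have "\<dots> \<le> real Q * real N * \<eta> powr \<theta>"
        by (intro mult_right_mono mult_left_mono N_ge) auto
      finally show ?thesis by simp
    qed
    moreover have "good n l N \<eta>"
      unfolding good_def
    proof (intro conjI allI impI)
      fix a :: real assume a: "0 \<le> a \<and> a + l / N / 2 \<le> 1"
      have "\<sigma> \<le> l / N / 2"
        using N_le \<sigma> N2 by (simp add: field_simps)
      then have "a + \<sigma> \<le> 1" using a by linarith
      with H[of a] a obtain y where y: "a \<le> y" "y + \<eta> \<le> a + \<sigma>" "{y..y + \<eta>} \<subseteq> E n"
        by blast
      have "y + \<eta> \<le> a + l / N / 2"
        using y(2) \<open>\<sigma> \<le> l / N / 2\<close> by linarith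
      with y show "\<exists>y. a \<le> y \<and> y + \<eta> \<le> a + l / N / 2 \<and> {y..y + \<eta>} \<subseteq> E n" by blast
    qed (rule N2)
    moreover have "n0 < n" using n by simp
    ultimately show ?thesis using \<eta>(1) by blast
  qed
  \<comment> \<open>A state consists of the time \<open>n\<close>, the length of the intervals and their number.\<close>
  define ok :: "nat \<times> real \<times> nat \<Rightarrow> bool" where
    "ok = (\<lambda>(n, l, Q). 0 < l \<and> 0 < Q \<and> 1 \<le> real Q * l powr \<theta>)"
  define nxt :: "nat \<times> real \<times> nat \<Rightarrow> nat \<times> real \<times> nat \<Rightarrow> bool" where
    "nxt = (\<lambda>(n, l, Q) (n', l', Q'). n < n' \<and> (\<exists>N. Q' = Q * N \<and> good n' l N l'))"
  have "\<exists>f. \<forall>k. (ok (f k) \<and> (k = 0 \<longrightarrow> f k = (0, 1, 1))) \<and> nxt (f k) (f (Suc k))"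
  proof (rule dependent_nat_choice)
    show "\<exists>x. ok x \<and> ((0::nat) = 0 \<longrightarrow> x = (0, 1, 1))"
      by (rule exI[of _ "(0, 1, 1)"]) (simp add: ok_def)
    fix x and k :: nat assume "ok x \<and> (k = 0 \<longrightarrow> x = (0, 1, 1))"
    moreover obtain n l Q where x: "x = (n, l, Q)" by (cases x)
    ultimately have "0 < l" "0 < Q" by (auto simp: ok_def)
    from step[OF this, of n] obtain n' h' N where s: "n < n'" "0 < h'"
      "1 \<le> real (Q * N) * h' powr \<theta>" "good n' l N h'" by blast
    have "0 < N" using s(4) by (simp add: good_def)
    then have "ok (n', h', Q * N)" using s \<open>0 < Q\<close> by (simp add: ok_def)
    moreover have "nxt x (n', h', Q * N)" using s by (auto simp: nxt_def x)
    ultimately show "\<exists>y. (ok y \<and> (Suc k = 0 \<longrightarrow> y = (0, 1, 1))) \<and> nxt x y" by blast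
  qed
  then obtain f where f: "\<And>k. ok (f k)" "f 0 = (0, 1, 1)" "\<And>k. nxt (f k) (f (Suc k))"
    by blast
  define n where "n k = fst (f k)" for k
  define h where "h k = fst (snd (f k))" for k
  define Q where "Q k = snd (snd (f k))" for k
  have fk: "f k = (n k, h k, Q k)" for k by (simp add: n_def h_def Q_def)
  have ok: "0 < h k" "1 \<le> real (Q k) * h k powr \<theta>" for k
    using f(1)[of k] by (simp_all add: fk ok_def)
  have start: "h 0 = 1" "Q 0 = 1" using f(2) by (simp_all add: fk)
  have n_less: "n k < n (Suc k)" for k using f(3)[of k] by (simp add: fk nxt_def)
  have "\<forall>k. \<exists>N. Q (Suc k) = Q k * N \<and> good (n (Suc k)) (h k) N (h (Suc k))"
    using f(3) by (simp add: fk nxt_def)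
  then obtain N where N: "\<And>k. Q (Suc k) = Q k * N k" "\<And>k. good (n (Suc k)) (h k) (N k) (h (Suc k))"
    by metis
  have "\<forall>k a. \<exists>y. 0 \<le> a \<and> a + h k / N k / 2 \<le> 1 \<longrightarrow>
      a \<le> y \<and> y + h (Suc k) \<le> a + h k / N k / 2 \<and> {y..y + h (Suc k)} \<subseteq> E (n (Suc k))"
    using N(2) unfolding good_def by metis
  then obtain sel where sel: "\<And>k a. 0 \<le> a \<Longrightarrow> a + h k / N k / 2 \<le> 1 \<Longrightarrow>
      a \<le> sel k a \<and> sel k a + h (Suc k) \<le> a + h k / N k / 2 \<and>
      {sel k a..sel k a + h (Suc k)} \<subseteq> E (n (Suc k))"
    by metis
  interpret nested_selection N Q h sel \<theta>
    using ok start N sel theta by unfold_locales (auto simp: good_def)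
  have mem: "limit_point t \<in> E (n (Suc k))" for t k
  proof -
    have "0 \<le> node k t + digit k t * width k"
      using node_range[of k t] width_pos[of k] by simp
    moreover have "node k t + digit k t * width k + width k / 2 \<le> 1"
      using node_range[of k t] piece_le[of k t] width_pos[of k] by linarith
    ultimately have "{node (Suc k) t..node (Suc k) t + h (Suc k)} \<subseteq> E (n (Suc k))"
      using sel by (simp add: width_def)
    then show ?thesis using limit_point_range[of "Suc k" t] by auto
  qed
  have "strict_mono n" using n_less by (simp add: strict_mono_Suc_iff)
  have "\<exists>\<^sub>\<infinity>m. limit_point t \<in> E m" for t
    unfolding INFM_nat_le
  proof
    fix m
    have "m \<le> n (Suc m)" using strict_mono_imp_increasing[OF \<open>strict_mono n\<close>, of "Suc m"] by simp
    then show "\<exists>j\<ge>m. limit_point t \<in> E j" using mem by blast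
  qed
  then show thesis
    using that[of limit_point] limit_point_range_01 limit_point_expanding by blast
qed

section \<open>Covering the hyperbolic neighbourhoods\<close>

lemma circle_dist_nonneg: "0 \<le> circle_dist x y"
  by (simp add: circle_dist_def infdist_nonneg)

lemma circle_dist_le_abs: "circle_dist x y \<le> \<bar>x - y\<bar>"
  using infdist_le[of 0 \<int> "x - y"] by (simp add: circle_dist_def)

lemma circle_dist_le_half: "circle_dist x y \<le> 1 / 2"
proof -
  have "dist (x - y) (of_int (round (x - y))) \<le> 1 / 2"
    using of_int_round_abs_le[of "x - y"] by (simp add: dist_real_def abs_minus_commute)
  then show ?thesis
    unfolding circle_dist_def by (intro infdist_le2[of "of_int (round (x - y))"]) auto
qed

lemma circle_dist_eq:
  assumes "x \<in> {0..<1}" "y \<in> {0..<1}"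
  obtains m :: int where "m \<in> {-1, 0, 1}" "circle_dist x y = \<bar>x - y - m\<bar>"
proof -
  obtain z where z: "z \<in> \<int>" "infdist (x - y) \<int> = dist (x - y) z"
    using infdist_attains_inf[of "\<int> :: real set" "x - y"] Ints_0 closed_Ints by (metis empty_iff)
  then obtain m :: int where m: "z = m" by (auto elim: Ints_cases)
  have eq: "circle_dist x y = \<bar>x - y - m\<bar>"
    using z m by (simp add: circle_dist_def dist_real_def)
  then have "\<bar>x - y - m\<bar> \<le> 1 / 2" using circle_dist_le_half[of x y] by simp
  then have "of_int m < (2 :: real)" "(-2 :: real) < of_int m"
    using assms unfolding atLeastLessThan_iff by linarith+
  then have "m < 2" "-2 < m" by linarith+
  then have "m \<in> {-1, 0, 1}" by auto
  with eq show ?thesis using that by blast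
qed

text \<open>On each cylinder of order \<open>n\<close> the map \<open>x \<mapsto> T\<^sup>n x - x\<close> is affine with slope \<open>\<beta> ^ n - 1\<close>, so the
  distance of \<open>T\<^sup>n x\<close> and \<open>x\<close> on the circle is \<open>\<beta> ^ n - 1\<close> times the distance of \<open>x\<close> to one of
  three points, one for each of the integers \<open>-1\<close>, \<open>0\<close> and \<open>1\<close>.\<close>

lemma recurrence_centres:
  assumes beta: "1 < \<beta>" and n: "1 \<le> n"
  obtains P where "finite P" "real (card P) \<le> 3 * (\<beta> / (\<beta> - 1)) * \<beta> ^ n"
    "\<And>x. x \<in> {0..<1} \<Longrightarrow>
       \<exists>p\<in>P. (\<beta> ^ n - 1) * \<bar>x - p\<bar> \<le> circle_dist ((beta_transform \<beta> ^^ n) x) x"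
proof -
  define b where "b = \<beta> ^ n"
  have b: "1 < b" using beta n by (simp add: b_def)
  define V where "V = cylinder_start \<beta> n ` {0..<1}"
  have V: "finite V" "real (card V) \<le> \<beta> / (\<beta> - 1) * b"
    using card_cylinder_starts[OF beta, of n] by (simp_all add: V_def b_def)
  define f :: "real \<times> int \<Rightarrow> real" where "f = (\<lambda>(v, m). (b * v + m) / (b - 1))"
  define P where "P = f ` (V \<times> {-1, 0, 1})"
  have "card P \<le> card (V \<times> {-1, 0, 1 :: int})"
    unfolding P_def using V by (intro card_image_le) auto
  also have "\<dots> = card V * 3" by (simp add: card_cartesian_product)
  finally have "real (card P) \<le> 3 * real (card V)" by simp
  also have "\<dots> \<le> 3 * (\<beta> / (\<beta> - 1) * b)" using V(2) by (intro mult_left_mono) auto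
  finally have card: "real (card P) \<le> 3 * (\<beta> / (\<beta> - 1)) * \<beta> ^ n" by (simp add: b_def)
  have "\<exists>p\<in>P. (\<beta> ^ n - 1) * \<bar>x - p\<bar> \<le> circle_dist ((beta_transform \<beta> ^^ n) x) x"
    if x: "x \<in> {0..<1}" for x
  proof -
    define u where "u = (beta_transform \<beta> ^^ n) x"
    define v where "v = cylinder_start \<beta> n x"
    have "u \<in> {0..<1}" unfolding u_def by (rule funpow_beta_transform_range[OF x])
    from circle_dist_eq[OF this x] obtain m
      where m: "m \<in> {-1, 0, 1}" "circle_dist u x = \<bar>u - x - of_int m\<bar>" .
    have "v = x - u / b" by (simp add: v_def u_def b_def cylinder_start_def)
    then have "u = b * (x - v)" using b by (simp add: field_simps)
    then have "u - x - m = (b - 1) * (x - f (v, m))"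
      using b by (simp add: f_def right_diff_distrib) (simp add: algebra_simps)
    then have "circle_dist u x = (b - 1) * \<bar>x - f (v, m)\<bar>"
      using m b by (simp add: abs_mult)
    moreover have "f (v, m) \<in> P" using m x by (auto simp: P_def V_def v_def)
    ultimately show ?thesis unfolding u_def b_def by (metis order_refl)
  qed
  with V card show ?thesis using that[of P] by (simp add: P_def)
qed

lemma sum_powr_le:
  assumes "0 \<le> \<kappa>" "\<kappa> < 1"
  shows "(1 - \<kappa>) * (\<Sum>m<M. (real m + 1) powr (- \<kappa>)) \<le> real M powr (1 - \<kappa>)"
proof (induction M)
  case (Suc M)
  define y where "y = real M + 1"
  have y: "1 \<le> y" by (simp add: y_def)
  have "real M powr (1 - \<kappa>) + (1 - \<kappa>) * y powr (- \<kappa>) \<le> y powr (1 - \<kappa>)"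
  proof (cases "M = 0")
    case True
    then show ?thesis using assms by (simp add: y_def)
  next
    case False
    then have "real M powr (1 - \<kappa>) * y powr \<kappa> \<le> (1 - \<kappa>) * real M + \<kappa> * y"
      using assms y by (intro Youngs_inequality_0) auto
    also have "\<dots> = y - (1 - \<kappa>)" by (simp add: y_def algebra_simps)
    finally have "real M powr (1 - \<kappa>) * y powr \<kappa> * y powr (- \<kappa>) \<le> (y - (1 - \<kappa>)) * y powr (- \<kappa>)"
      by (rule mult_right_mono) simp
    moreover have "y powr \<kappa> * y powr (- \<kappa>) = 1" "y * y powr (- \<kappa>) = y powr (1 - \<kappa>)"
      using y by (simp_all add: powr_minus powr_diff field_simps)
    ultimately show ?thesis by (simp add: mult.assoc left_diff_distrib)
  qed
  then show ?case using Suc.IH by (simp add: y_def distrib_left add.commute[of 1])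
qed simp

text \<open>Rankin's method: bounding the indicator of \<open>\<Prod> f \<le> R\<close> by \<open>(R / \<Prod> f) powr \<kappa>\<close> makes the count
  factorize over the coordinates, at the cost of a power of \<open>R\<close> with exponent close to \<open>1\<close> instead of
  the logarithms of the exact count.\<close>

lemma card_prod_le_bound:
  fixes f :: "'n::finite \<Rightarrow> 'i \<Rightarrow> real"
  assumes fin: "\<And>i. finite (\<Lambda> i)" and pos: "\<And>i l. l \<in> \<Lambda> i \<Longrightarrow> 0 < f i l"
    and R: "0 < R" and \<kappa>: "0 \<le> \<kappa>"
  shows "real (card {g \<in> PiE UNIV \<Lambda>. (\<Prod>i\<in>UNIV. f i (g i)) \<le> R})
     \<le> R powr \<kappa> * (\<Prod>i\<in>UNIV. \<Sum>l\<in>\<Lambda> i. f i l powr (- \<kappa>))"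
proof -
  let ?S = "{g \<in> PiE UNIV \<Lambda>. (\<Prod>i\<in>UNIV. f i (g i)) \<le> R}"
  have finP: "finite (PiE UNIV \<Lambda>)" using fin by (intro finite_PiE) auto
  have one: "1 \<le> R powr \<kappa> * (\<Prod>i\<in>UNIV. f i (g i) powr (- \<kappa>))" if "g \<in> ?S" for g
  proof -
    define F where "F = (\<Prod>i\<in>UNIV. f i (g i))"
    have F: "0 < F" unfolding F_def using that pos by (intro prod_pos) (auto simp: PiE_def)
    have "F powr \<kappa> \<le> R powr \<kappa>" using that F \<kappa> by (intro powr_mono2) (auto simp: F_def)
    then have "F powr \<kappa> * F powr (- \<kappa>) \<le> R powr \<kappa> * F powr (- \<kappa>)" by (rule mult_right_mono) simp
    moreover have "F powr \<kappa> * F powr (- \<kappa>) = 1" using F by (simp add: powr_minus)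
    ultimately show ?thesis unfolding F_def prod_powr_distrib by simp
  qed
  have "real (card ?S) = (\<Sum>g\<in>?S. 1)" by simp
  also have "\<dots> \<le> (\<Sum>g\<in>?S. R powr \<kappa> * (\<Prod>i\<in>UNIV. f i (g i) powr (- \<kappa>)))"
    by (intro sum_mono one)
  also have "\<dots> \<le> (\<Sum>g\<in>PiE UNIV \<Lambda>. R powr \<kappa> * (\<Prod>i\<in>UNIV. f i (g i) powr (- \<kappa>)))"
    using finP by (intro sum_mono2) (auto intro!: mult_nonneg_nonneg prod_nonneg)
  also have "\<dots> = R powr \<kappa> * (\<Prod>i\<in>UNIV. \<Sum>l\<in>\<Lambda> i. f i l powr (- \<kappa>))"
    using fin by (simp add: prod_sum_PiE sum_distrib_left)
  finally show ?thesis .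
qed

lemma prod_add_le:
  fixes y :: "'a \<Rightarrow> real"
  assumes "finite S" "\<And>i. i \<in> S \<Longrightarrow> 0 \<le> y i \<and> y i \<le> 1" "0 \<le> r" "r \<le> 1"
  shows "(\<Prod>i\<in>S. y i + r) \<le> (\<Prod>i\<in>S. y i) + (2 ^ card S - 1) * r"
  using assms(1,2)
proof (induction S rule: finite_induct)
  case (insert i S)
  define p where "p = (\<Prod>i\<in>S. y i)"
  define c :: real where "c = 2 ^ card S - 1"
  have p: "p \<le> 1" unfolding p_def using insert.prems by (intro prod_le_1) auto
  have c: "0 \<le> c" by (simp add: c_def)
  have yi: "0 \<le> y i" "y i \<le> 1" using insert.prems by auto
  have "(\<Prod>i\<in>insert i S. y i + r) = (y i + r) * (\<Prod>i\<in>S. y i + r)"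
    using insert.hyps by simp
  also have "\<dots> \<le> (y i + r) * (p + c * r)"
    using insert.IH insert.prems yi assms(3) unfolding p_def c_def by (intro mult_left_mono) auto
  also have "\<dots> = y i * p + y i * (c * r) + r * p + r * (c * r)"
    by (simp add: algebra_simps)
  also have "\<dots> \<le> y i * p + 1 * (c * r) + r * 1 + 1 * (c * r)"
    using yi p c assms(3,4) by (intro add_mono mult_mono mult_right_mono mult_left_mono) auto
  also have "\<dots> = (\<Prod>i\<in>insert i S. y i) + (2 ^ card (insert i S) - 1) * r"
    using insert.hyps by (simp add: p_def c_def algebra_simps)
  finally show ?case .
qed simp

text \<open>A cube of side \<open>\<delta>\<close> is indexed by its position relative to a centre \<open>p\<close> in each coordinate, so
  that the size of \<open>|T\<^sup>n x\<^sub>i - x\<^sub>i|\<close> on it can be read off from the multiple \<open>m\<close> of \<open>\<delta>\<close>.\<close>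

definition grid_cube :: "real \<Rightarrow> ('n \<Rightarrow> real \<times> bool \<times> nat) \<Rightarrow> (real ^ 'n) set" where
  "grid_cube \<delta> g = {x. \<forall>i. case g i of (p, right, m) \<Rightarrow>
      x $ i \<in> (if right then {p + m * \<delta>..p + (m + 1) * \<delta>} else {p - (m + 1) * \<delta>..p - m * \<delta>})}"

lemma grid_cube_diameter:
  fixes g :: "'n::finite \<Rightarrow> real \<times> bool \<times> nat" and \<delta> :: real
  assumes "0 \<le> \<delta>"
  shows "bounded (grid_cube \<delta> g) \<and> diameter (grid_cube \<delta> g) \<le> CARD('n) * \<delta>"
proof -
  have dist: "norm (x - y) \<le> CARD('n) * \<delta>" if "x \<in> grid_cube \<delta> g" "y \<in> grid_cube \<delta> g" for x y
  proof -
    have "\<bar>(x - y) $ i\<bar> \<le> \<delta>" for i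
    proof (cases "g i")
      case (fields p right m)
      then show ?thesis
        using that unfolding grid_cube_def
        by (auto simp: algebra_simps split: if_splits dest!: spec[of _ i])
    qed
    then have "(\<Sum>i\<in>UNIV. \<bar>(x - y) $ i\<bar>) \<le> (\<Sum>i\<in>(UNIV :: 'n set). \<delta>)" by (intro sum_mono)
    then show ?thesis using norm_le_l1_cart[of "x - y"] by simp
  qed
  have "bounded (grid_cube \<delta> g)"
    unfolding bounded_two_points dist_norm using dist by blast
  moreover have "diameter (grid_cube \<delta> g) \<le> CARD('n) * \<delta>"
    using dist assms by (intro diameter_le) auto
  ultimately show ?thesis ..
qed

text \<open>The scale \<open>\<delta> = r / B ^ n\<close> is so small that moving a point by \<open>\<delta>\<close> changes each \<open>|T\<^sup>n x\<^sub>i - x\<^sub>i|\<close> by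
  at most \<open>r\<close>, which keeps the product below \<open>2 ^ d * r\<close>. Hence the number of cubes is comparable
  to \<open>\<delta> ^ (- d)\<close> times the volume of the set, up to replacing \<open>r\<close> by \<open>r powr \<kappa>\<close>.\<close>

lemma hyperbolic_neighbourhood_cover:
  fixes \<beta> :: "'n::finite \<Rightarrow> real" and n :: nat
  assumes beta: "\<And>i. 1 < \<beta> i" "\<And>i. \<beta> i \<le> B" and n: "1 \<le> n"
    and r: "0 < r" "r \<le> 1" and \<kappa>: "0 \<le> \<kappa>" "\<kappa> < 1"
  obtains I :: "('n \<Rightarrow> real \<times> bool \<times> nat) set" where "finite I"
    "real (card I) \<le> (2 ^ CARD('n) * r) powr \<kappa> *
       (\<Prod>i\<in>UNIV. 12 * (\<beta> i / (\<beta> i - 1))\<^sup>2 / (1 - \<kappa>) / (r / B ^ n))"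
    "\<And>x. x \<in> torus \<Longrightarrow> (\<Prod>i\<in>UNIV. circle_dist ((beta_transform (\<beta> i) ^^ n) (x $ i)) (x $ i)) < r \<Longrightarrow>
       \<exists>g\<in>I. x \<in> grid_cube (r / B ^ n) g"
proof -
  define \<delta> where "\<delta> = r / B ^ n"
  have B: "1 < B" using beta less_le_trans by blast
  have \<delta>: "0 < \<delta>" using r B by (simp add: \<delta>_def)
  define a where "a i = (\<beta> i ^ n - 1) * \<delta>" for i
  have b: "1 < \<beta> i ^ n" for i using beta n by simp
  have a: "0 < a i" for i using b[of i] \<delta> by (simp add: a_def)
  have ar: "a i \<le> r" for i
  proof -
    have "a i \<le> B ^ n * \<delta>"
      unfolding a_def using beta[of i] \<delta> power_mono[of "\<beta> i" B n] by (intro mult_right_mono) auto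
    then show ?thesis using B by (simp add: \<delta>_def)
  qed
  define centres where "centres i P \<longleftrightarrow> finite P \<and> real (card P) \<le> 3 * (\<beta> i / (\<beta> i - 1)) * \<beta> i ^ n \<and>
    (\<forall>x\<in>{0..<1}. \<exists>p\<in>P. (\<beta> i ^ n - 1) * \<bar>x - p\<bar> \<le> circle_dist ((beta_transform (\<beta> i) ^^ n) x) x)" for i P
  have "\<exists>P. centres i P" for i
    unfolding centres_def by (rule recurrence_centres[OF beta(1) n, of i]) blast
  then obtain P where "\<And>i. centres i (P i)" by metis
  then have P: "finite (P i)" "real (card (P i)) \<le> 3 * (\<beta> i / (\<beta> i - 1)) * \<beta> i ^ n"
    "\<And>x. x \<in> {0..<1} \<Longrightarrow>
      \<exists>p\<in>P i. (\<beta> i ^ n - 1) * \<bar>x - p\<bar> \<le> circle_dist ((beta_transform (\<beta> i) ^^ n) x) x" for i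
    by (auto simp: centres_def)
  \<comment> \<open>bounds the multiples of \<open>\<delta>\<close> that occur, since \<open>circle_dist\<close> is at most \<open>1 / 2\<close>\<close>
  define M where "M i = nat \<lfloor>1 / (2 * a i)\<rfloor> + 1" for i
  define \<Lambda> where "\<Lambda> i = P i \<times> (UNIV :: bool set) \<times> {..<M i}" for i
  define f where "f i = (\<lambda>(p :: real, right :: bool, m :: nat). a i * (real m + 1))" for i
  define I where "I = {g \<in> PiE UNIV \<Lambda>. (\<Prod>i\<in>UNIV. f i (g i)) \<le> 2 ^ CARD('n) * r}"
  have fin\<Lambda>: "finite (\<Lambda> i)" for i using P by (simp add: \<Lambda>_def)
  have finI: "finite I" unfolding I_def using fin\<Lambda> by (simp add: finite_PiE)
  \<comment> \<open>\<open>12\<close> collects three centres per cylinder, two sides of a centre and the factor \<open>2\<close> from \<open>M i \<le> 2 / a i\<close>\<close>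
  have sum: "(\<Sum>l\<in>\<Lambda> i. f i l powr (- \<kappa>)) \<le> 12 * (\<beta> i / (\<beta> i - 1))\<^sup>2 / (1 - \<kappa>) / \<delta>" for i
  proof -
    define c where "c = \<beta> i / (\<beta> i - 1)"
    have c: "0 < c" using beta[of i] by (simp add: c_def)
    have "(\<Sum>l\<in>\<Lambda> i. f i l powr (- \<kappa>)) = card (P i) * (2 * (\<Sum>m<M i. (a i * (real m + 1)) powr (- \<kappa>)))"
      by (simp add: \<Lambda>_def f_def sum.cartesian_product' UNIV_bool)
    also have "(\<Sum>m<M i. (a i * (real m + 1)) powr (- \<kappa>)) = a i powr (- \<kappa>) * (\<Sum>m<M i. (real m + 1) powr (- \<kappa>))"
      using a[of i] by (simp add: powr_mult sum_distrib_left)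
    also have "(\<Sum>m<M i. (real m + 1) powr (- \<kappa>)) \<le> M i powr (1 - \<kappa>) / (1 - \<kappa>)"
      using sum_powr_le[OF \<kappa>, of "M i"] \<kappa> by (simp add: pos_le_divide_eq mult.commute)
    also have "M i powr (1 - \<kappa>) \<le> (2 / a i) powr (1 - \<kappa>)"
    proof (rule powr_mono2)
      have "real (M i) \<le> 1 / (2 * a i) + 1" using a[of i] by (simp add: M_def)
      also have "\<dots> \<le> 2 / a i" using a[of i] ar[of i] r by (simp add: field_simps)
      finally show "real (M i) \<le> 2 / a i" .
    qed (use \<kappa> in auto)
    also have "(2 / a i) powr (1 - \<kappa>) \<le> 2 / a i powr (1 - \<kappa>)"
      using a[of i] \<kappa> powr_mono[of "1 - \<kappa>" 1 2] by (simp add: powr_divide divide_right_mono)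
    finally have "(\<Sum>l\<in>\<Lambda> i. f i l powr (- \<kappa>)) \<le>
        card (P i) * (2 * (a i powr (- \<kappa>) * (2 / a i powr (1 - \<kappa>) / (1 - \<kappa>))))"
      using \<kappa> by (simp add: mult_left_mono divide_right_mono)
    also have "a i powr (- \<kappa>) * (2 / a i powr (1 - \<kappa>) / (1 - \<kappa>)) = 2 / (1 - \<kappa>) / a i"
      using a[of i] \<kappa> by (simp add: powr_minus powr_diff field_simps)
    also have "card (P i) * (2 * (2 / (1 - \<kappa>) / a i)) \<le> (3 * c * \<beta> i ^ n) * (2 * (2 / (1 - \<kappa>) / a i))"
      using P(2)[of i] \<kappa> a[of i] by (intro mult_right_mono) (auto simp: c_def)
    also have "\<dots> = 12 * c * (\<beta> i ^ n / (\<beta> i ^ n - 1)) / (1 - \<kappa>) / \<delta>"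
      by (simp add: a_def mult_ac)
    also have "\<dots> \<le> 12 * c * c / (1 - \<kappa>) / \<delta>"
    proof -
      have "\<beta> i \<le> \<beta> i ^ n" using beta[of i] n self_le_power[of "\<beta> i" n] by auto
      then have "\<beta> i ^ n / (\<beta> i ^ n - 1) \<le> c"
        using beta[of i] b[of i] by (simp add: c_def field_simps)
      then show ?thesis using c \<kappa> \<delta> by (intro divide_right_mono mult_left_mono) auto
    qed
    finally show ?thesis by (simp add: c_def power2_eq_square mult.assoc)
  qed
  have "real (card I) \<le> (2 ^ CARD('n) * r) powr \<kappa> * (\<Prod>i\<in>UNIV. \<Sum>l\<in>\<Lambda> i. f i l powr (- \<kappa>))"
    unfolding I_def using r \<kappa> fin\<Lambda> a by (intro card_prod_le_bound) (auto simp: f_def)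
  also have "\<dots> \<le> (2 ^ CARD('n) * r) powr \<kappa> * (\<Prod>i\<in>UNIV. 12 * (\<beta> i / (\<beta> i - 1))\<^sup>2 / (1 - \<kappa>) / \<delta>)"
    using sum by (intro mult_left_mono prod_mono) (auto intro!: sum_nonneg)
  finally have card: "real (card I) \<le> \<dots>" .
  have "\<exists>g\<in>I. x \<in> grid_cube \<delta> g"
    if x: "x \<in> torus" and small: "(\<Prod>i\<in>UNIV. circle_dist ((beta_transform (\<beta> i) ^^ n) (x $ i)) (x $ i)) < r" for x
  proof -
    define y where "y i = circle_dist ((beta_transform (\<beta> i) ^^ n) (x $ i)) (x $ i)" for i
    have "\<exists>p\<in>P i. (\<beta> i ^ n - 1) * \<bar>x $ i - p\<bar> \<le> y i" for i
      using P(3)[of "x $ i" i] x by (simp add: torus_def y_def)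
    then obtain p where p: "\<And>i. p i \<in> P i" "\<And>i. (\<beta> i ^ n - 1) * \<bar>x $ i - p i\<bar> \<le> y i"
      by metis
    define m where "m i = nat \<lfloor>\<bar>x $ i - p i\<bar> / \<delta>\<rfloor>" for i
    define g where "g i = (p i, p i \<le> x $ i, m i)" for i
    have m: "m i * \<delta> \<le> \<bar>x $ i - p i\<bar>" "\<bar>x $ i - p i\<bar> \<le> (m i + 1) * \<delta>" for i
    proof -
      have "0 \<le> \<bar>x $ i - p i\<bar> / \<delta>" using \<delta> by simp
      then have "m i \<le> \<bar>x $ i - p i\<bar> / \<delta>" "\<bar>x $ i - p i\<bar> / \<delta> \<le> m i + 1"
        unfolding m_def by linarith+
      then show "m i * \<delta> \<le> \<bar>x $ i - p i\<bar>" "\<bar>x $ i - p i\<bar> \<le> (m i + 1) * \<delta>"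
        using \<delta> by (simp_all add: field_simps)
    qed
    have am: "a i * m i \<le> y i" for i
    proof -
      have "a i * m i = (\<beta> i ^ n - 1) * (m i * \<delta>)" by (simp add: a_def)
      also have "\<dots> \<le> (\<beta> i ^ n - 1) * \<bar>x $ i - p i\<bar>" using m(1) b[of i] by (intro mult_left_mono) auto
      finally show ?thesis using p(2)[of i] by linarith
    qed
    have y: "0 \<le> y i" "y i \<le> 1 / 2" for i
      unfolding y_def by (rule circle_dist_nonneg circle_dist_le_half)+
    have "m i < M i" for i
    proof -
      have "a i * m i \<le> 1 / 2" using am[of i] y(2)[of i] by linarith
      then have "m i \<le> 1 / (2 * a i)" using a[of i] by (simp add: field_simps)
      then show ?thesis unfolding M_def by linarith
    qed
    then have g: "g \<in> PiE UNIV \<Lambda>" using p(1) by (auto simp: g_def \<Lambda>_def)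
    have "(\<Prod>i\<in>UNIV. f i (g i)) \<le> (\<Prod>i\<in>UNIV. y i + r)"
    proof (rule prod_mono)
      fix i
      have "a i * (real (m i) + 1) \<le> y i + r" using am[of i] ar[of i] by (simp add: distrib_left)
      then show "0 \<le> f i (g i) \<and> f i (g i) \<le> y i + r" using a[of i] by (simp add: f_def g_def)
    qed
    also have "\<dots> \<le> (\<Prod>i\<in>UNIV. y i) + (2 ^ CARD('n) - 1) * r"
    proof (rule prod_add_le)
      show "0 \<le> y i \<and> y i \<le> 1" for i using y[of i] by simp
    qed (use r in auto)
    also have "\<dots> \<le> 2 ^ CARD('n) * r"
      using small by (simp add: y_def left_diff_distrib)
    finally have "g \<in> I" using g by (simp add: I_def)
    moreover have "x \<in> grid_cube \<delta> g"
    proof -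
      have "x $ i \<in> (if p i \<le> x $ i then {p i + m i * \<delta>..p i + (real (m i) + 1) * \<delta>}
          else {p i - (real (m i) + 1) * \<delta>..p i - m i * \<delta>})" for i
        using m[of i] by (auto simp: add.commute[of 1])
      then show ?thesis by (simp add: grid_cube_def g_def add.commute)
    qed
    ultimately show ?thesis by blast
  qed
  then show thesis
    using that[of I] finI card unfolding \<delta>_def by blast
qed

text \<open>The covers at level \<open>n\<close> contribute at most a constant times \<open>r powr \<kappa> * \<delta> powr (s - d)\<close> with
  \<open>r = exp (- t * n)\<close> and \<open>\<delta> = exp (- (t + ln B) * n)\<close>. The condition on \<open>s\<close> says that this decays
  exponentially for \<open>\<kappa> = 1\<close>, hence also for some \<open>\<kappa> < 1\<close>.\<close>

lemma hausdorff_measure_recurrent_eq_0: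
  fixes \<beta> :: "'n::finite \<Rightarrow> real" and A :: "(real ^ 'n) set"
  assumes beta: "\<And>i. 1 < \<beta> i" "\<And>i. \<beta> i \<le> B" and t: "0 \<le> t" and A: "A \<subseteq> torus"
    and rec: "\<And>x. x \<in> A \<Longrightarrow>
      \<exists>\<^sub>\<infinity>n. (\<Prod>i\<in>UNIV. circle_dist ((beta_transform (\<beta> i) ^^ n) (x $ i)) (x $ i)) < exp (- t * n)"
    and s: "real CARD('n) - 1 + ln B / (t + ln B) < s"
  shows "hausdorff_measure s A = 0"
proof -
  define L where "L = ln B"
  define d where "d = real CARD('n)"
  have B: "1 < B" using beta less_le_trans by blast
  have L: "0 < L" using B by (simp add: L_def)
  have d: "1 \<le> d" by (simp add: d_def Suc_le_eq)
  have "0 \<le> L / (t + L)" using L t by simp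
  then have s0: "0 < s" using s d unfolding d_def[symmetric] L_def[symmetric] by linarith
  have gap: "(t + L) * (d - s) < t"
  proof -
    have "d - s < 1 - L / (t + L)" using s by (simp add: d_def L_def)
    also have "\<dots> = t / (t + L)" using L t by (simp add: field_simps)
    finally show ?thesis using L t by (simp add: pos_less_divide_eq mult.commute)
  qed
  \<comment> \<open>for \<open>t = 0\<close> the whole torus is covered and \<open>d < s\<close>, so no gain from the product is needed\<close>
  obtain \<kappa> where \<kappa>: "0 \<le> \<kappa>" "\<kappa> < 1" "(t + L) * (d - s) < \<kappa> * t"
  proof (cases "t = 0")
    case True
    then show ?thesis using that[of 0] gap by simp
  next
    case False
    with t have tpos: "0 < t" by simp
    have "max 0 ((t + L) * (d - s) / t) < 1" using gap tpos by simp
    then obtain \<kappa> where "max 0 ((t + L) * (d - s) / t) < \<kappa>" "\<kappa> < 1" using dense by blast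
    then show ?thesis using that[of \<kappa>] tpos by (simp add: pos_divide_less_eq)
  qed
  define r where "r n = exp (- t * real n)" for n
  define \<delta> where "\<delta> n = r n / B ^ n" for n
  have r: "0 < r n" "r n \<le> 1" for n using t by (simp_all add: r_def)
  have \<delta>_exp: "\<delta> n = exp (- (t + L) * n)" for n
  proof -
    have "B ^ n = exp (n * L)" using B by (simp add: exp_of_nat_mult L_def)
    then have "\<delta> n = exp (- t * n - n * L)" by (simp add: \<delta>_def r_def exp_diff)
    then show ?thesis by (simp add: algebra_simps)
  qed
  define K where "K = (\<Prod>i\<in>(UNIV :: 'n set). 12 * (\<beta> i / (\<beta> i - 1))\<^sup>2 / (1 - \<kappa>))"
  define covers where "covers n I \<longleftrightarrow> finite I \<and> (n = 0 \<longrightarrow> I = {}) \<and>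
    (1 \<le> n \<longrightarrow> real (card I) \<le> (2 ^ CARD('n) * r n) powr \<kappa> *
       (\<Prod>i\<in>UNIV. 12 * (\<beta> i / (\<beta> i - 1))\<^sup>2 / (1 - \<kappa>) / (r n / B ^ n)) \<and>
     (\<forall>x\<in>torus. (\<Prod>i\<in>UNIV. circle_dist ((beta_transform (\<beta> i) ^^ n) (x $ i)) (x $ i)) < r n \<longrightarrow>
       (\<exists>g\<in>I. x \<in> grid_cube (r n / B ^ n) g)))" for n and I :: "('n \<Rightarrow> real \<times> bool \<times> nat) set"
  have "\<exists>I. covers n I" for n
  proof (cases "n = 0")
    case True
    then show ?thesis by (intro exI[of _ "{}"]) (simp add: covers_def)
  next
    case False
    then have n: "1 \<le> n" by simp
    show ?thesis
      by (rule hyperbolic_neighbourhood_cover[OF beta n r \<kappa>(1,2)]) (use n in \<open>auto simp: covers_def\<close>)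
  qed
  then obtain I where I: "\<And>n. covers n (I n)" by metis
  define q where "q = exp ((t + L) * (d - s) - \<kappa> * t)"
  have q: "0 \<le> q" "q < 1" using \<kappa>(3) by (simp_all add: q_def)
  define C where "C = (2 ^ CARD('n)) powr \<kappa> * K * d powr s"
  show ?thesis
  proof (rule hausdorff_measure_limsup_eq_0[OF s0])
    fix x assume x: "x \<in> A"
    have "\<forall>\<^sub>\<infinity>n. 1 \<le> (n :: nat)"
      unfolding cofinite_eq_sequentially by (rule eventually_ge_at_top)
    from INFM_conjI[OF rec[OF x] this]
    show "\<exists>\<^sub>\<infinity>n. \<exists>g\<in>I n. x \<in> grid_cube (\<delta> n) g"
    proof (rule INFM_mono, elim conjE)
      fix n :: nat
      assume "(\<Prod>i\<in>UNIV. circle_dist ((beta_transform (\<beta> i) ^^ n) (x $ i)) (x $ i)) < exp (- t * real n)" "1 \<le> n"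
      then show "\<exists>g\<in>I n. x \<in> grid_cube (\<delta> n) g"
        using I[of n] x A unfolding covers_def \<delta>_def r_def by blast
    qed
  next
    show "finite (I n)" for n using I[of n] by (simp add: covers_def)
    show "bounded (grid_cube (\<delta> n) g) \<and> diameter (grid_cube (\<delta> n) g) \<le> d * \<delta> n" for n and g :: "'n \<Rightarrow> real \<times> bool \<times> nat"
      unfolding d_def by (rule grid_cube_diameter) (simp add: \<delta>_exp)
    have "(\<lambda>n. exp (- (t + L)) ^ n) \<longlonglongrightarrow> 0"
      using L t by (intro LIMSEQ_power_zero) simp
    then have "\<delta> \<longlonglongrightarrow> 0"
      by (simp add: \<delta>_exp[abs_def] exp_of_nat_mult[symmetric] mult.commute)
    then show "(\<lambda>n. d * \<delta> n) \<longlonglongrightarrow> 0" by (rule tendsto_mult_right_zero)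
    show "summable (\<lambda>n. card (I n) * (d * \<delta> n) powr s)"
    proof (rule summable_comparison_test')
      show "summable (\<lambda>n. C * q ^ n)" using q by (intro summable_mult summable_geometric) auto
      fix n :: nat assume n: "1 \<le> n"
      have \<delta>: "0 < \<delta> n" by (simp add: \<delta>_exp)
      have "real (card (I n)) \<le> (2 ^ CARD('n) * r n) powr \<kappa> * (K / \<delta> n ^ CARD('n))"
        using I[of n] n unfolding covers_def \<delta>_def[symmetric] prod_dividef[of _ "\<lambda>_. \<delta> n"] K_def by simp
      then have "card (I n) * (d * \<delta> n) powr s \<le>
          (2 ^ CARD('n) * r n) powr \<kappa> * (K / \<delta> n ^ CARD('n)) * (d * \<delta> n) powr s"
        by (rule mult_right_mono) simp
      also have "\<dots> = C * (r n powr \<kappa> * (\<delta> n powr s / \<delta> n ^ CARD('n)))"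
        using r[of n] d \<delta> by (simp add: C_def powr_mult)
      also have "\<delta> n powr s / \<delta> n ^ CARD('n) = \<delta> n powr (s - d)"
        using \<delta> by (simp add: d_def powr_diff powr_realpow)
      also have "r n powr \<kappa> * \<delta> n powr (s - d) = q ^ n"
        unfolding r_def \<delta>_exp exp_powr_real q_def exp_of_nat_mult[symmetric] exp_add[symmetric]
        by (simp add: algebra_simps)
      finally show "norm (card (I n) * (d * \<delta> n) powr s) \<le> C * q ^ n" by simp
    qed
  qed
qed

section \<open>Recurrent points in one coordinate\<close>

text \<open>A full cylinder \<open>[v, v + \<beta>\<^sup>-\<^sup>n)\<close> has in its closure the fixed point \<open>p = v / (1 - \<beta>\<^sup>-\<^sup>n)\<close> of its
  affine branch, and \<open>T\<^sup>n x - x = (\<beta> ^ n - 1) * (x - p)\<close> on the cylinder. An interval of length \<open>\<eta>\<close>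
  next to \<open>p\<close> is taken on that side of \<open>p\<close> where the cylinder is longer; on the left it keeps
  distance \<open>\<eta>\<close> from \<open>p\<close>, which may be the excluded right endpoint.\<close>

lemma recurrent_interval:
  assumes beta: "1 < \<beta>" and n: "1 \<le> n" and r: "0 < r" "r \<le> 1"
    and a: "0 \<le> a" "a + 3 * (real n + 1) / \<beta> ^ n \<le> 1"
  obtains y where "a \<le> y" "y + r / (4 * \<beta> ^ n) \<le> a + 3 * (real n + 1) / \<beta> ^ n"
    "{y..y + r / (4 * \<beta> ^ n)} \<subseteq> {x. circle_dist ((beta_transform \<beta> ^^ n) x) x < r}"
proof -
  define b where "b = \<beta> ^ n"
  have b: "1 < b" using beta n by (simp add: b_def)
  \<comment> \<open>the density of full cylinders is stated with a strict inequality, hence \<open>3\<close> in place of \<open>2\<close>\<close>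
  have "2 * (real n + 1) / b < 3 * (real n + 1) / b"
    using b by (intro divide_strict_right_mono) auto
  with a obtain v where v: "v \<in> full_starts \<beta> n" "a \<le> v" "v + 1 / b \<le> a + 3 * (real n + 1) / b"
    unfolding b_def by (elim full_cylinder_in_interval[OF beta, rotated 2]) auto
  define p where "p = b * v / (b - 1)"
  define \<eta> where "\<eta> = r / (4 * b)"
  have \<eta>: "0 < \<eta>" "4 * \<eta> \<le> 1 / b" "4 * (b * \<eta>) = r"
    using r b by (simp_all add: \<eta>_def divide_right_mono)
  have v0: "0 \<le> v" and v1: "v + 1 / b \<le> 1"
    using full_starts_nonneg[OF beta v(1)] full_starts_le[OF beta v(1)] by (simp_all add: b_def)
  have p_eq: "p = v + p / b" using b by (simp add: p_def field_simps)
  have "b * v + 1 \<le> b" using mult_left_mono[OF v1, of b] b by (simp add: distrib_left)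
  then have "0 \<le> p" "p \<le> 1" using b v0 by (simp_all add: p_def)
  then have "0 \<le> p / b" "p / b \<le> 1 / b" using b by (simp_all add: divide_right_mono)
  then have p: "v \<le> p" "p \<le> v + 1 / b" using p_eq by linarith+
  have close: "circle_dist ((beta_transform \<beta> ^^ n) x) x < r"
    if x: "v \<le> x" "x < v + 1 / b" "\<bar>x - p\<bar> \<le> 2 * \<eta>" for x
  proof -
    have "(beta_transform \<beta> ^^ n) x = b * (x - v)"
      using full_starts_iterate[OF beta v(1), of x] x by (simp add: b_def)
    also have "b * (x - v) - x = (b - 1) * (x - p)"
      using b by (simp add: p_def field_simps)
    finally have "circle_dist ((beta_transform \<beta> ^^ n) x) x \<le> (b - 1) * \<bar>x - p\<bar>"
      using circle_dist_le_abs[of "(beta_transform \<beta> ^^ n) x" x] b by (simp add: abs_mult)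
    also have "\<dots> \<le> b * (2 * \<eta>)" using x(3) b by (intro mult_mono) auto
    also have "\<dots> < r" using \<eta>(3) r by simp
    finally show ?thesis .
  qed
  define y where "y = (if p \<le> v + 1 / b / 2 then p else p - 2 * \<eta>)"
  have y: "v \<le> y" "y + \<eta> < v + 1 / b"
    using p \<eta> by (auto simp: y_def)
  have "\<bar>x - p\<bar> \<le> 2 * \<eta>" if "x \<in> {y..y + \<eta>}" for x
    using that \<eta>(1) by (auto simp: y_def split: if_splits)
  then have "{y..y + \<eta>} \<subseteq> {x. circle_dist ((beta_transform \<beta> ^^ n) x) x < r}"
    using close y by auto
  moreover have "a \<le> y" "y + \<eta> \<le> a + 3 * (real n + 1) / b" using y v by linarith+
  ultimately show thesis using that unfolding \<eta>_def b_def by blast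
qed

text \<open>The intervals have length \<open>exp (- (t + ln \<beta>) * n) / 4\<close> and occur with spacing
  \<open>3 * (n + 1) * exp (- ln \<beta> * n)\<close>, so any exponent \<open>\<theta> < ln \<beta> / (t + ln \<beta>)\<close> is admissible.\<close>

lemma expanding_map_into_recurrent:
  assumes beta: "1 < \<beta>" and t: "0 \<le> t" and \<theta>: "0 < \<theta>" "\<theta> * (t + ln \<beta>) < ln \<beta>"
    and freq: "\<exists>\<^sub>\<infinity>n. exp (- t * real n) \<le> \<psi> n"
  shows "\<exists>\<gamma> :: real \<Rightarrow> real.
    (\<forall>s\<in>{0..<1}. \<gamma> s \<in> {0..<1} \<and>
      (\<exists>\<^sub>\<infinity>n. circle_dist ((beta_transform \<beta> ^^ n) (\<gamma> s)) (\<gamma> s) < \<psi> n)) \<and>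
    (\<forall>s\<in>{0..<1}. \<forall>s'\<in>{0..<1}. \<bar>s - s'\<bar> \<le> 4 * \<bar>\<gamma> s - \<gamma> s'\<bar> powr \<theta>)"
proof -
  define L where "L = ln \<beta>"
  have L: "0 < L" using beta by (simp add: L_def)
  define E where "E n = {x. circle_dist ((beta_transform \<beta> ^^ n) x) x < \<psi> n}" for n
  \<comment> \<open>the exponential rate of \<open>\<sigma> / \<eta> powr \<theta>\<close>\<close>
  define x where "x = exp (\<theta> * (t + L) - L)"
  have x: "0 < x" "x < 1" using \<theta> by (simp_all add: x_def L_def)
  have "\<theta> * (t + L) < 1 * (t + L)" using \<theta> t L_def by simp
  then have \<theta>1: "\<theta> < 1" using t L by (simp only: mult_less_cancel_right_pos add_nonneg_pos)
  have \<beta>n: "\<beta> ^ n = exp (n * L)" for n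
    using beta by (simp add: L_def exp_of_nat_mult)
  have "(\<lambda>n. 3 * 4 powr \<theta> * (of_nat n * x ^ n + x ^ n)) \<longlonglongrightarrow> 3 * 4 powr \<theta> * (0 + 0)"
    using x by (intro tendsto_intros powser_times_n_limit_0 LIMSEQ_power_zero) auto
  then have lim: "(\<lambda>n. 3 * 4 powr \<theta> * (real n * x ^ n + x ^ n)) \<longlonglongrightarrow> 0" by simp
  show ?thesis
  proof (rule expanding_map_into_limsup[of \<theta> E])
    fix \<epsilon> :: real and n0 :: nat assume \<epsilon>: "0 < \<epsilon>"
    have "\<forall>\<^sub>F n in sequentially. 3 * 4 powr \<theta> * (real n * x ^ n + x ^ n) < \<epsilon> \<and> max n0 1 \<le> n"
      using order_tendstoD(2)[OF lim \<epsilon>] eventually_ge_at_top by (rule eventually_conj)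
    then have "\<exists>\<^sub>\<infinity>n. exp (- t * real n) \<le> \<psi> n \<and> 3 * 4 powr \<theta> * (real n * x ^ n + x ^ n) < \<epsilon> \<and> max n0 1 \<le> n"
      using freq unfolding cofinite_eq_sequentially by (intro frequently_eventually_frequently)
    then obtain n where n: "exp (- t * real n) \<le> \<psi> n" "n0 \<le> n" "1 \<le> n"
      and small: "3 * 4 powr \<theta> * (real n * x ^ n + x ^ n) < \<epsilon>"
      by (auto dest!: frequently_ex)
    define r where "r = exp (- t * real n)"
    define \<sigma> where "\<sigma> = 3 * (real n + 1) / \<beta> ^ n"
    define \<eta> where "\<eta> = r / (4 * \<beta> ^ n)"
    have r: "0 < r" "r \<le> 1" using t by (simp_all add: r_def)
    have "1 < \<beta> ^ n" using beta n by simp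
    then have "0 < \<sigma>" "0 < \<eta>" "\<eta> \<le> 1" using r by (simp_all add: \<sigma>_def \<eta>_def)
    moreover have "\<sigma> < \<epsilon> * \<eta> powr \<theta>"
    proof -
      have \<eta>_exp: "\<eta> = exp (- (t + L) * n) / 4"
        unfolding \<eta>_def r_def \<beta>n by (simp add: exp_diff[symmetric] algebra_simps flip: divide_divide_eq_left)
      define e where "e = exp (- (t + L) * n * \<theta>)"
      have "\<eta> powr \<theta> = e / 4 powr \<theta>"
        unfolding \<eta>_exp e_def by (simp only: powr_divide exp_powr_real)
      moreover have "x ^ n * e = exp (- L * n)"
        by (simp add: x_def e_def exp_of_nat_mult[symmetric] exp_add[symmetric] algebra_simps)
      moreover have "\<sigma> = 3 * (real n + 1) * exp (- L * n)"
        unfolding \<sigma>_def \<beta>n by (simp add: exp_minus field_simps)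
      ultimately have "\<sigma> = 3 * 4 powr \<theta> * (real n * x ^ n + x ^ n) * \<eta> powr \<theta>"
        by (simp add: distrib_right mult.assoc)
      then show ?thesis using small \<open>0 < \<eta>\<close> by simp
    qed
    moreover have "\<exists>y. a \<le> y \<and> y + \<eta> \<le> a + \<sigma> \<and> {y..y + \<eta>} \<subseteq> E n" if "0 \<le> a \<and> a + \<sigma> \<le> 1" for a
    proof -
      have "0 \<le> a" "a + 3 * (real n + 1) / \<beta> ^ n \<le> 1"
        using that by (simp_all add: \<sigma>_def)
      then obtain y where y: "a \<le> y" "y + \<eta> \<le> a + \<sigma>"
        "{y..y + \<eta>} \<subseteq> {x. circle_dist ((beta_transform \<beta> ^^ n) x) x < r}"
        unfolding \<sigma>_def \<eta>_def by (rule recurrent_interval[OF beta n(3) r])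
      moreover have "{x. circle_dist ((beta_transform \<beta> ^^ n) x) x < r} \<subseteq> E n"
        using n(1) by (auto simp: E_def r_def)
      ultimately show ?thesis by blast
    qed
    ultimately show "\<exists>n\<ge>n0. \<exists>\<sigma> \<eta>. 0 < \<sigma> \<and> 0 < \<eta> \<and> \<eta> \<le> 1 \<and> \<sigma> < \<epsilon> * \<eta> powr \<theta> \<and>
       (\<forall>a. 0 \<le> a \<and> a + \<sigma> \<le> 1 \<longrightarrow> (\<exists>y. a \<le> y \<and> y + \<eta> \<le> a + \<sigma> \<and> {y..y + \<eta>} \<subseteq> E n))"
      using n(2) by blast
  next
    fix \<gamma> :: "real \<Rightarrow> real"
    assume "\<And>s. s \<in> {0..<1} \<Longrightarrow> \<gamma> s \<in> {0..<1}" "\<And>s. s \<in> {0..<1} \<Longrightarrow> \<exists>\<^sub>\<infinity>n. \<gamma> s \<in> E n"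
      "\<And>s s'. s \<in> {0..<1} \<Longrightarrow> s' \<in> {0..<1} \<Longrightarrow> \<bar>s - s'\<bar> \<le> 4 * \<bar>\<gamma> s - \<gamma> s'\<bar> powr \<theta>"
    then show ?thesis unfolding E_def mem_Collect_eq by blast
  qed (use \<theta> \<theta>1 in auto)
qed

section \<open>The dimension formula\<close>

lemma prod_circle_dist_le:
  fixes x y :: "'n::finite \<Rightarrow> real"
  shows "(\<Prod>i\<in>UNIV. circle_dist (x i) (y i)) \<le> circle_dist (x j) (y j)"
proof -
  have "(\<Prod>i\<in>UNIV. circle_dist (x i) (y i)) =
      circle_dist (x j) (y j) * (\<Prod>i\<in>UNIV - {j}. circle_dist (x i) (y i))"
    by (rule prod.remove) auto
  also have "\<dots> \<le> circle_dist (x j) (y j) * 1"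
  proof (intro mult_left_mono prod_le_1)
    fix i
    show "0 \<le> circle_dist (x i) (y i) \<and> circle_dist (x i) (y i) \<le> 1"
      using circle_dist_nonneg[of "x i" "y i"] circle_dist_le_half[of "x i" "y i"] by linarith
  qed (rule circle_dist_nonneg)
  finally show ?thesis by simp
qed

text \<open>The factors of the other coordinates are at most \<open>1\<close>.\<close>

lemma hyperbolic_recurrentI:
  fixes T :: "real ^ 'n ^ 'n"
  assumes "y \<in> torus" "c \<in> {0..<1}"
    and "\<exists>\<^sub>\<infinity>n. circle_dist ((beta_transform (T $ j $ j) ^^ n) c) c < \<psi> n"
  shows "(\<chi> i. if i = j then c else y $ i) \<in> hyperbolic_recurrent T \<psi>"
proof -
  define z where "z = (\<chi> i. if i = j then c else y $ i)"
  have zj: "z $ j = c" by (simp add: z_def)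
  have "z \<in> torus" using assms(1,2) by (auto simp: torus_def z_def)
  moreover have "\<exists>\<^sub>\<infinity>n. (\<Prod>i\<in>UNIV. circle_dist ((beta_transform (T $ i $ i) ^^ n) (z $ i)) (z $ i)) < \<psi> n"
    using assms(3)
  proof (rule INFM_mono)
    fix n assume "circle_dist ((beta_transform (T $ j $ j) ^^ n) c) c < \<psi> n"
    then show "(\<Prod>i\<in>UNIV. circle_dist ((beta_transform (T $ i $ i) ^^ n) (z $ i)) (z $ i)) < \<psi> n"
      using prod_circle_dist_le[of "\<lambda>i. (beta_transform (T $ i $ i) ^^ n) (z $ i)" "\<lambda>i. z $ i" j]
      by (simp add: zj)
  qed
  ultimately show ?thesis by (simp add: hyperbolic_recurrent_def z_def)
qed

lemma frequently_exp_le: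
  fixes \<psi> :: "nat \<Rightarrow> real"
  assumes pos: "\<And>n. 1 \<le> n \<Longrightarrow> 0 < \<psi> n"
    and less: "liminf (\<lambda>n. ereal (- ln (\<psi> n) / real n)) < ereal t"
  shows "\<exists>\<^sub>\<infinity>n. exp (- t * real n) \<le> \<psi> n"
proof -
  have "\<exists>\<^sub>F n in sequentially. \<not> ereal t \<le> ereal (- ln (\<psi> n) / real n)"
    using less Liminf_bounded[of "ereal t" "\<lambda>n. ereal (- ln (\<psi> n) / real n)" sequentially]
    unfolding frequently_def by auto
  from frequently_eventually_frequently[OF this eventually_ge_at_top[of 1]]
  show ?thesis
    unfolding cofinite_eq_sequentially
  proof (rule frequently_elim1, elim conjE)
    fix n :: nat assume n: "\<not> ereal t \<le> ereal (- ln (\<psi> n) / real n)" "1 \<le> n"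
    then have "- ln (\<psi> n) / n < t" by (simp only: ereal_less_eq not_le)
    then have "- t * n \<le> ln (\<psi> n)" using n(2) by (subst (asm) pos_divide_less_eq) auto
    then show "exp (- t * real n) \<le> \<psi> n" using pos[OF n(2)] by (metis exp_le_cancel_iff exp_ln)
  qed
qed

lemma eventually_less_exp:
  fixes \<psi> :: "nat \<Rightarrow> real"
  assumes pos: "\<And>n. 1 \<le> n \<Longrightarrow> 0 < \<psi> n"
    and less: "ereal t < liminf (\<lambda>n. ereal (- ln (\<psi> n) / real n))"
  shows "\<forall>\<^sub>\<infinity>n. \<psi> n < exp (- t * real n)"
  unfolding cofinite_eq_sequentially
  using eventually_conj[OF less_LiminfD[OF less] eventually_ge_at_top[of 1]]
proof (rule eventually_mono, elim conjE)
  fix n :: nat assume n: "ereal t < ereal (- ln (\<psi> n) / real n)" "1 \<le> n"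
  then have "t < - ln (\<psi> n) / n" by (simp only: less_ereal.simps)
  then have "ln (\<psi> n) < - t * n" using n(2) by (subst (asm) pos_less_divide_eq) auto
  then show "\<psi> n < exp (- t * real n)" using pos[OF n(2)] by (metis exp_less_cancel_iff exp_ln)
qed

theorem theorem1p1:
  fixes T :: "real ^ ('n::{finite,linorder}) ^ ('n::{finite,linorder})"
    and \<beta> :: "'n::{finite,linorder} \<Rightarrow> real"
    and \<psi> :: "nat \<Rightarrow> real"
    and \<tau> :: ereal
  assumes nonsingular: "invertible T"
    and diagonal: "\<And>i j. i \<noteq> j \<Longrightarrow> T $ i $ j = 0"
    and eigenvalues: "\<And>i. T $ i $ i = \<beta> i"
    and beta_gt_1: "\<And>i. 1 < \<beta> i"
    and beta_mono: "mono \<beta>"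
    and psi_pos: "\<And>n. n \<ge> 1 \<Longrightarrow> 0 < \<psi> n"
    and tau: "\<tau> = liminf (\<lambda>n. ereal (- ln (\<psi> n) / real n))"
    and tau_nonneg: "0 \<le> \<tau>"
  shows "hausdorff_dim (hyperbolic_recurrent T \<psi>) =
    ereal (real CARD('n) - 1) + ereal (ln (\<beta> (Max UNIV))) / (\<tau> + ereal (ln (\<beta> (Max UNIV))))"
proof -
  define j where "j = Max (UNIV :: 'n set)"
  define L where "L = ln (\<beta> j)"
  define d where "d = real CARD('n)"
  let ?H = "hyperbolic_recurrent T \<psi>"
  have L: "0 < L" using beta_gt_1[of j] by (simp add: L_def)
  have beta_le: "\<beta> i \<le> \<beta> j" for i using beta_mono by (simp add: j_def monoD)
  have d: "1 \<le> d" by (simp add: d_def Suc_le_eq)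
  have torus: "?H \<subseteq> torus" by (auto simp: hyperbolic_recurrent_def)

  have upper: "hausdorff_measure s ?H = 0"
    if t: "0 \<le> t" and tt: "t = 0 \<or> ereal t < \<tau>" and s: "d - 1 + L / (t + L) < s" for s t
  proof (rule hausdorff_measure_recurrent_eq_0[OF beta_gt_1 beta_le t torus])
    fix x assume "x \<in> ?H"
    then have x: "\<exists>\<^sub>\<infinity>n. (\<Prod>i\<in>UNIV. circle_dist ((beta_transform (\<beta> i) ^^ n) (x $ i)) (x $ i)) < \<psi> n"
      by (simp add: hyperbolic_recurrent_def eigenvalues)
    show "\<exists>\<^sub>\<infinity>n. (\<Prod>i\<in>UNIV. circle_dist ((beta_transform (\<beta> i) ^^ n) (x $ i)) (x $ i)) < exp (- t * real n)"
      using tt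
    proof
      assume "t = 0"
      have "(\<Prod>i\<in>UNIV. circle_dist ((beta_transform (\<beta> i) ^^ n) (x $ i)) (x $ i)) < 1" for n
        using prod_circle_dist_le[of "\<lambda>i. (beta_transform (\<beta> i) ^^ n) (x $ i)" "\<lambda>i. x $ i" j]
          circle_dist_le_half[of "(beta_transform (\<beta> j) ^^ n) (x $ j)" "x $ j"] by linarith
      then show ?thesis using \<open>t = 0\<close> by simp
    next
      assume "ereal t < \<tau>"
      then have "\<forall>\<^sub>\<infinity>n. \<psi> n < exp (- t * real n)"
        using psi_pos unfolding tau by (intro eventually_less_exp) auto
      from INFM_conjI[OF x this] show ?thesis by (rule INFM_mono) auto
    qed
  qed (use s in \<open>simp add: d_def L_def\<close>)

  show ?thesis
  proof (cases \<tau>)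
    case (real r)
    have r: "0 \<le> r" using tau_nonneg real by simp
    define D where "D = d - 1 + L / (r + L)"
    have D0: "0 < L / (r + L)" using L r by simp
    have "hausdorff_dim ?H = ereal D"
    proof (rule hausdorff_dim_eqI)
      show "0 \<le> D" using d D0 by (simp add: D_def)
    next
      fix s assume s: "D < s"
      show "hausdorff_measure s ?H = 0"
      proof (cases "r = 0")
        case True
        then show ?thesis using upper[of 0 s] s by (simp add: D_def)
      next
        case False
        \<comment> \<open>lower \<open>r\<close> to some \<open>t\<close> so slightly that \<open>s\<close> stays above the critical value\<close>
        define e where "e = s - (d - 1)"
        have e: "L / (r + L) < e" using s by (simp add: D_def e_def)
        then have epos: "0 < e" using D0 by linarith
        have "L < e * (r + L)" using e L r by (simp add: pos_divide_less_eq)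
        then have "L / e < r + L" using epos by (simp add: pos_divide_less_eq mult.commute)
        then have "max 0 (L / e - L) < r" using r False by simp
        then obtain t where t: "max 0 (L / e - L) < t" "t < r" using dense by blast
        then have "L / e < t + L" "0 < t" by simp_all
        then have "L / (t + L) < e"
          using epos L by (simp add: pos_divide_less_eq mult.commute)
        then show ?thesis using upper[of t s] t real by (simp add: e_def)
      qed
    next
      fix s assume s: "0 \<le> s" "s < D"
      have "max 0 (s - (d - 1)) < L / (r + L)" using s D0 by (simp add: D_def)
      then obtain \<theta> where \<theta>: "max 0 (s - (d - 1)) < \<theta>" "\<theta> < L / (r + L)" using dense by blast
      have \<theta>0: "0 < \<theta>" using \<theta> by simp
      have "\<theta> * (r + L) < L" using \<theta>(2) L r by (simp add: pos_less_divide_eq)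
      then have "r < L / \<theta> - L" using \<theta>0 by (simp add: pos_less_divide_eq field_simps)
      then obtain t where t: "r < t" "t < L / \<theta> - L" using dense by blast
      have tL: "\<theta> * (t + L) < L" using t(2) \<theta>0 by (simp add: field_simps)
      have freq: "\<exists>\<^sub>\<infinity>n. exp (- t * real n) \<le> \<psi> n"
        using psi_pos t(1) real unfolding tau by (intro frequently_exp_le) auto
      have "0 \<le> t" using t(1) r by simp
      from expanding_map_into_recurrent[OF beta_gt_1[of j] this \<theta>0 tL[unfolded L_def] freq]
      obtain \<gamma> :: "real \<Rightarrow> real" where
        \<gamma>: "\<forall>s\<in>{0..<1}. \<gamma> s \<in> {0..<1} \<and>
          (\<exists>\<^sub>\<infinity>n. circle_dist ((beta_transform (\<beta> j) ^^ n) (\<gamma> s)) (\<gamma> s) < \<psi> n)"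
        and expanding: "\<forall>s\<in>{0..<1}. \<forall>s'\<in>{0..<1}. \<bar>s - s'\<bar> \<le> 4 * \<bar>\<gamma> s - \<gamma> s'\<bar> powr \<theta>"
        by blast
      have "hausdorff_measure (real CARD('n) - 1 + \<theta>) ?H \<noteq> 0"
      proof (rule hausdorff_measure_fibred_ne_0[where C = 4 and \<gamma> = \<gamma> and ?i0.0 = j])
        fix y :: "real ^ ('n::{finite,linorder})" assume y: "y \<in> torus"
        then have "y $ j \<in> {0..<1}" by (simp add: torus_def)
        then have "(\<chi> i. if i = j then \<gamma> (y $ j) else y $ i) \<in> ?H"
          using \<gamma> y by (intro hyperbolic_recurrentI) (auto simp: eigenvalues)
        also have "(\<chi> i. if i = j then \<gamma> (y $ j) else y $ i) = (\<chi> i. if i = j then \<gamma> (y $ i) else y $ i)"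
          by (simp add: vec_eq_iff)
        finally show "(\<chi> i. if i = j then \<gamma> (y $ i) else y $ i) \<in> ?H" .
      next
        fix a b r :: real assume *: "a \<in> {0..<1}" "b \<in> {0..<1}" "\<bar>\<gamma> a - \<gamma> b\<bar> \<le> r"
        have "\<bar>\<gamma> a - \<gamma> b\<bar> powr \<theta> \<le> r powr \<theta>" using *(3) \<theta>0 by (intro powr_mono2) auto
        then show "\<bar>a - b\<bar> \<le> 4 * (if \<theta> = 0 then 1 else r powr \<theta>)"
          using expanding[rule_format, OF *(1,2)] \<theta>0 by simp
      qed (use \<theta>0 in auto)
      then show "hausdorff_measure s ?H \<noteq> 0"
        using hausdorff_measure_eq_0_mono[of s "d - 1 + \<theta>" ?H] s \<theta>(1) by (auto simp: d_def)
    qed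
    then show ?thesis
      using L r by (simp add: real D_def L_def j_def d_def)
  next
    case PInf
    have "hausdorff_dim ?H = ereal (d - 1)"
    proof (rule hausdorff_dim_eqI)
      show "0 \<le> d - 1" using d by simp
    next
      fix s assume s: "d - 1 < s"
      \<comment> \<open>\<open>t = L / e\<close> is large enough for \<open>L / (t + L) < e\<close>\<close>
      define e where "e = s - (d - 1)"
      have e: "0 < e" using s by (simp add: e_def)
      have "L < e * (L / e + L)" using e L by (simp add: distrib_left)
      then have "L / (L / e + L) < e" using e L by (simp add: pos_divide_less_eq add_pos_pos)
      then show "hausdorff_measure s ?H = 0"
        using upper[of "L / e" s] e L PInf by (simp add: e_def)
    next
      fix s assume s: "0 \<le> s" "s < d - 1"
      have fixed: "(beta_transform (\<beta> j) ^^ n) 0 = 0" for n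
        by (induction n) (simp_all add: beta_transform_def)
      have "\<exists>\<^sub>\<infinity>n. circle_dist ((beta_transform (\<beta> j) ^^ n) 0) 0 < \<psi> n"
        unfolding INFM_nat_le
      proof
        fix m :: nat
        show "\<exists>n\<ge>m. circle_dist ((beta_transform (\<beta> j) ^^ n) 0) 0 < \<psi> n"
          using psi_pos[of "Suc m"] fixed[of "Suc m"]
          by (intro exI[of _ "Suc m"]) (simp add: circle_dist_def del: funpow.simps)
      qed
      then have "hausdorff_measure (real CARD('n) - 1 + 0) ?H \<noteq> 0"
        by (intro hausdorff_measure_fibred_ne_0[where C = 1 and \<gamma> = "\<lambda>_. 0" and ?i0.0 = j]
            hyperbolic_recurrentI) (auto simp: eigenvalues)
      then show "hausdorff_measure s ?H \<noteq> 0"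
        using hausdorff_measure_eq_0_mono[of s "d - 1" ?H] s by (auto simp: d_def)
    qed
    then show ?thesis by (simp add: PInf d_def)
  next
    case MInf
    then show ?thesis using tau_nonneg by simp
  qed
qed

end
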